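(* Let $X$ be a multi-set of size $n$ and set $C_\delta := 1699200 \cdot \log(2n)\log^2(2\mu_X)$, $C_\alpha := 42480\cdot\log(2\mu_X)$, $C_\lambda := 169920\cdot\log(2\mu_X)$. If $X$ is $C_\delta$-dense and has no $C_\alpha$-almost divisor, then for $\lambda_X := C_\lambda \cdot \mu_X \max(X)\, \Sigma(X)/|X|^2$ we have \[ \{\lambda_X, \lambda_X+1, \dots, \Sigma(X)-\lambda_X\} \subseteq \mathcal{S}(X). \]
   Context: For a finite non-empty multi-set $X$ of positive integers: $|X|$ is the number of elements counted with multiplicity, $\max(X)$ its maximum element, $\mu_X$ the largest multiplicity of any number in $X$, $\Sigma(X)$ the sum of all elements (with multiplicity), and $\mathcal{S}(X) := \{\Sigma(Y)\mid Y\subseteq X\}$ the set of all subset sums. $X$ is $\delta$-dense if $|X|^2 \ge \delta\cdot\mu_X\cdot\max(X)$. For an integer $d$, $X(d) := X\cap d\mathbb{Z}$ is the multi-set of elements of $X$ divisible by $d$, and $\overline{X(d)} := X\setminus X(d)$. An integer $d>1$ is an $\alpha$-almost divisor of $X$ if $|\overline{X(d)}| \le \alpha\cdot\mu_X\cdot\Sigma(X)/|X|^2$. *)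

theory Defs
  imports Complex_Main "HOL-Library.Multiset"
begin

definition max_multiplicity :: "nat multiset \<Rightarrow> nat" where
  "max_multiplicity X = Max (count X ` set_mset X)"

definition subset_sums :: "nat multiset \<Rightarrow> nat set" where
  "subset_sums X = {\<Sum>\<^sub># Y | Y. Y \<subseteq># X}"

definition dense_mset :: "real \<Rightarrow> nat multiset \<Rightarrow> bool" where
  "dense_mset \<delta> X \<longleftrightarrow>
     (real (size X))\<^sup>2 \<ge> \<delta> * real (max_multiplicity X) * real (Max_mset X)"

definition divisible_part :: "nat multiset \<Rightarrow> nat \<Rightarrow> nat multiset" where
  "divisible_part X d = {# x \<in># X. d dvd x #}"

definition nondivisible_part :: "nat multiset \<Rightarrow> nat \<Rightarrow> nat multiset" where
  "nondivisible_part X d = X - divisible_part X d"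

definition almost_divisor :: "real \<Rightarrow> nat multiset \<Rightarrow> nat \<Rightarrow> bool" where
  "almost_divisor \<alpha> X d \<longleftrightarrow> d > 1 \<and>
     real (size (nondivisible_part X d))
       \<le> \<alpha> * real (max_multiplicity X) * real (\<Sum>\<^sub># X) / (real (size X))\<^sup>2"

end

theory Submission
  imports Defs "HOL-Library.Set_Algebras" "HOL-Number_Theory.Cong" "HOL-Computational_Algebra.Primes"
begin

text \<open>
  Write \<open>n\<close>, \<open>m\<close>, \<open>S\<close>, \<open>\<mu>\<close> for the size, maximum, sum and largest multiplicity of \<open>X\<close>, and
  \<open>\<tau> = C_alpha * \<mu> * S / n\<^sup>2\<close>.
  Split \<open>X = R + A + G\<close>. The part \<open>R\<close> is small but still has at least \<open>\<tau>\<close> (rounded down) elements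
  outside every \<open>p\<int>\<close>, so that its subset sums cover all residues modulo every \<open>d \<le> \<tau>\<close>.
  The subset sums of \<open>A\<close> contain an arithmetic progression of length \<open>2 * m\<close> with some step
  \<open>d \<le> \<tau>\<close>. Hence \<open>R + A\<close> yields an interval of length at least \<open>m\<close>, which the elements of \<open>G\<close>,
  added one by one, extend beyond \<open>S / 2\<close>; the upper half follows by complementation.

  For the progression, pigeonholing over multiplicities gives a set \<open>D\<close> all of whose elements occur
  \<open>K\<close> times, and pigeonholing over pair sums gives a set \<open>E\<close> of numbers with many representations
  as a sum of two elements of \<open>D\<close>. After an affine normalisation \<open>E\<close> contains \<open>0\<close> and its maximum
  \<open>q\<close> and has greatest common divisor 1. Modulo \<open>q\<close>, the iterated sumsets of \<open>E\<close> grow by about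
  \<open>card E / 2\<close> in each step (Olson's inequality, proved with the Dyson transform), so after
  \<open>O(q / card E)\<close> steps they cover all residues, and adding copies of \<open>q\<close> fills an interval.
\<close>

section \<open>Periodic sets of integers\<close>

text \<open>Subsets of the cyclic group of order \<open>q\<close> are encoded as
  \<open>q\<close>-periodic sets of integers, and \<open>residue_count\<close> is their cardinality
  there. Sumsets, translates and divisibility then live in the integers, without quotients.\<close>

definition periodic :: "int \<Rightarrow> int set \<Rightarrow> bool" where
  "periodic q A \<longleftrightarrow> (\<forall>x. x mod q \<in> A \<longleftrightarrow> x \<in> A)"

definition residue_count :: "int \<Rightarrow> int set \<Rightarrow> nat" where
  "residue_count q A = card (A \<inter> {0..<q})"

text \<open>Only the inclusion of \<open>A + x\<close> in \<open>A\<close> is demanded. For periodic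
  \<open>A\<close> with positive period this already gives a subgroup, hence the usual
  stabiliser.\<close>

definition stab :: "int set \<Rightarrow> int set" where
  "stab A = {x. \<forall>a\<in>A. a + x \<in> A}"

lemma periodic_cong:
  assumes "periodic q A" "x \<in> A" "[x = y] (mod q)"
  shows "y \<in> A"
  using assms by (metis cong_def periodic_def)

lemma periodicI:
  assumes "\<And>x y. x \<in> A \<Longrightarrow> [x = y] (mod q) \<Longrightarrow> y \<in> A"
  shows "periodic q A"
  unfolding periodic_def using assms by (metis cong_def mod_mod_trivial)

lemma periodic_Un: "periodic q A \<Longrightarrow> periodic q B \<Longrightarrow> periodic q (A \<union> B)"
  and periodic_Int: "periodic q A \<Longrightarrow> periodic q B \<Longrightarrow> periodic q (A \<inter> B)"
  by (auto simp: periodic_def)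

lemma periodic_translate:
  assumes "periodic q A"
  shows "periodic q (t +o A)"
proof (rule periodicI)
  fix x y assume "x \<in> t +o A" and c: "[x = y] (mod q)"
  then obtain a where a: "a \<in> A" "x = t + a" by (auto simp: elt_set_plus_def)
  have "[a = y - t] (mod q)" using cong_diff[OF c cong_refl[of t]] a by simp
  then have "y - t \<in> A" using assms a periodic_cong by blast
  then show "y \<in> t +o A" by (force simp: elt_set_plus_def)
qed

lemma periodic_sumset:
  assumes "periodic q A"
  shows "periodic q (A + B)"
proof (rule periodicI)
  fix x y assume "x \<in> A + B" and c: "[x = y] (mod q)"
  then obtain a b where ab: "a \<in> A" "b \<in> B" "x = a + b" by (auto elim: set_plus_elim)
  have "[a = y - b] (mod q)" using cong_diff[OF c cong_refl[of b]] ab by simp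
  then have "y - b \<in> A" using assms ab periodic_cong by blast
  then have "(y - b) + b \<in> A + B" using ab by (intro set_plus_intro)
  then show "y \<in> A + B" by simp
qed

lemma periodic_stab:
  assumes "periodic q A"
  shows "periodic q (stab A)"
proof (rule periodicI)
  fix x y assume x: "x \<in> stab A" and c: "[x = y] (mod q)"
  show "y \<in> stab A"
    unfolding stab_def
  proof clarify
    fix a assume "a \<in> A"
    with x have "a + x \<in> A" by (auto simp: stab_def)
    moreover have "[a + x = a + y] (mod q)" using c by (simp add: cong_add)
    ultimately show "a + y \<in> A" using assms periodic_cong by blast
  qed
qed

lemma residue_count_mono: "A \<subseteq> B \<Longrightarrow> residue_count q A \<le> residue_count q B"
  unfolding residue_count_def by (intro card_mono) auto

lemma residue_count_Un_Int:
  "residue_count q (A \<union> B) + residue_count q (A \<inter> B) = residue_count q A + residue_count q B"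
proof -
  have "(A \<union> B) \<inter> {0..<q} = (A \<inter> {0..<q}) \<union> (B \<inter> {0..<q})"
    "(A \<inter> B) \<inter> {0..<q} = (A \<inter> {0..<q}) \<inter> (B \<inter> {0..<q})" by auto
  then show ?thesis unfolding residue_count_def
    using card_Un_Int[of "A \<inter> {0..<q}" "B \<inter> {0..<q}"] by simp
qed

lemma residue_count_le: "0 \<le> q \<Longrightarrow> residue_count q A \<le> nat q"
  unfolding residue_count_def using card_mono[of "{0..<q}" "A \<inter> {0..<q}"] by simp

lemma residue_count_psubset:
  assumes "q > 0" "periodic q A" "periodic q B" "A \<subset> B"
  shows "residue_count q A < residue_count q B"
proof -
  obtain b where b: "b \<in> B" "b \<notin> A" using assms by auto
  have "b mod q \<in> B" "b mod q \<notin> A" using b assms by (auto simp: periodic_def)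
  then have "A \<inter> {0..<q} \<subset> B \<inter> {0..<q}" using assms by fastforce
  then show ?thesis unfolding residue_count_def by (intro psubset_card_mono) auto
qed

lemma periodic_UNIV: "periodic q UNIV"
  by (simp add: periodic_def)

lemma residue_count_lt:
  assumes "q > 0" "periodic q A" "A \<noteq> UNIV"
  shows "residue_count q A < nat q"
  using residue_count_psubset[OF assms(1,2) periodic_UNIV] assms residue_count_le[of q UNIV]
  by (simp add: psubset_eq)

lemma residue_count_pos:
  assumes "q > 0" "periodic q A" "A \<noteq> {}"
  shows "residue_count q A > 0"
  using residue_count_psubset[of q "{}" A] assms by (simp add: periodic_def psubset_eq)

lemma residue_count_translate:
  assumes q: "q > 0" and A: "periodic q A"
  shows "residue_count q (t +o A) = residue_count q A"
proof -
  have le: "residue_count q B \<le> residue_count q (s +o B)" if B: "periodic q B" for B s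
    unfolding residue_count_def
  proof (rule card_inj_on_le)
    show "inj_on (\<lambda>x. (s + x) mod q) (B \<inter> {0..<q})"
    proof (rule inj_onI)
      fix x y assume xy: "x \<in> B \<inter> {0..<q}" "y \<in> B \<inter> {0..<q}" "(s + x) mod q = (s + y) mod q"
      then have "[s + x = s + y] (mod q)" by (simp add: cong_def)
      then have "[x = y] (mod q)" by (simp add: cong_add_lcancel)
      then show "x = y" using xy by (simp add: cong_def)
    qed
    show "(\<lambda>x. (s + x) mod q) ` (B \<inter> {0..<q}) \<subseteq> (s +o B) \<inter> {0..<q}"
      using periodic_translate[OF B, of s] q
      by (auto simp: periodic_def elt_set_plus_def)
  qed auto
  have "- t +o (t +o A) = A" by (force simp: elt_set_plus_def)
  then show ?thesis using le[OF A, of t] le[OF periodic_translate[OF A], of t "- t"] by simp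
qed

subsection \<open>Stabilisers\<close>

lemma stab_0: "0 \<in> stab A"
  by (simp add: stab_def)

lemma stab_add: "x \<in> stab A \<Longrightarrow> y \<in> stab A \<Longrightarrow> x + y \<in> stab A"
  by (simp add: stab_def add.assoc[symmetric])

lemma stab_of_nat_mult: "x \<in> stab A \<Longrightarrow> int k * x \<in> stab A"
  by (induction k) (auto simp: stab_0 algebra_simps intro: stab_add)

text \<open>Modulo \<open>q\<close>, the inverse of \<open>x\<close> is its multiple
  \<open>(q - 1) * x\<close>.\<close>

lemma stab_uminus:
  assumes q: "q > 0" and A: "periodic q A" and x: "x \<in> stab A"
  shows "- x \<in> stab A"
proof -
  have "int (nat (q - 1)) * x \<in> stab A" using x by (rule stab_of_nat_mult)
  moreover have "int (nat (q - 1)) * x = - x + x * q" using q by (simp add: algebra_simps)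
  moreover have "[- x + x * q = - x] (mod q)" by (simp add: cong_iff_dvd_diff)
  ultimately show ?thesis using periodic_cong[OF periodic_stab[OF A]] by metis
qed

lemma stab_mult:
  assumes "q > 0" "periodic q A" "x \<in> stab A"
  shows "k * x \<in> stab A"
proof (cases "k \<ge> 0")
  case True
  then show ?thesis using stab_of_nat_mult[OF assms(3), of "nat k"] by simp
next
  case False
  then show ?thesis using stab_of_nat_mult[OF stab_uminus[OF assms], of "nat (- k)"] by simp
qed

text \<open>A subgroup of the integers containing \<open>q\<close> is generated by its least
  positive element. This turns questions on stabilisers into divisibility.\<close>

lemma stab_eq_multiples:
  assumes q: "q > 0" and A: "periodic q A"
  obtains g where "g > 0" "stab A = {x. g dvd x}"
proof -
  have "q \<in> stab A" using periodic_cong[OF periodic_stab[OF A] stab_0, of q] by (simp add: cong_def)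
  then have ex: "\<exists>n::nat. n > 0 \<and> int n \<in> stab A" using q by (intro exI[of _ "nat q"]) simp
  define n where "n = (LEAST n::nat. n > 0 \<and> int n \<in> stab A)"
  have n: "n > 0" "int n \<in> stab A" using LeastI_ex[OF ex] by (auto simp: n_def)
  have "int n dvd x" if x: "x \<in> stab A" for x
  proof (rule ccontr)
    assume nd: "\<not> int n dvd x"
    have "x + (- (x div int n)) * int n \<in> stab A"
      by (intro stab_add x stab_mult[OF q A] n)
    moreover have "x + (- (x div int n)) * int n = x mod int n"
      by (simp add: minus_div_mult_eq_mod)
    ultimately have m: "x mod int n \<in> stab A" by simp
    have pos: "x mod int n > 0"
      using nd n by (metis dvd_eq_mod_eq_0 mod_int_pos_iff of_nat_0_less_iff order_less_le)
    then have "n \<le> nat (x mod int n)" using m unfolding n_def by (intro Least_le) auto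
    moreover have "x mod int n < int n" using n by simp
    ultimately show False using pos by linarith
  qed
  moreover have "x \<in> stab A" if "int n dvd x" for x
    using that stab_mult[OF q A n(2)] by (metis dvd_def mult.commute)
  ultimately show ?thesis using n that[of "int n"] by auto
qed

section \<open>Olson's inequality for sumsets in cyclic groups\<close>

text \<open>Induction on \<open>B\<close> by Dyson's transform: while some \<open>e\<close> in
  \<open>A\<close> has \<open>e + B\<close> not inside \<open>A\<close>, the transform keeps the
  total size, does not enlarge the sumset, and shrinks \<open>B\<close>. In the end \<open>B\<close>
  lies in the stabiliser of \<open>A\<close>, and \<open>S = A\<close> works.\<close>

lemma exists_periodic_between:
  assumes q: "q > 0" and "periodic q A" "periodic q B" "0 \<in> B" "A \<noteq> {}"
  shows "\<exists>S. periodic q S \<and> A \<subseteq> S \<and> S \<subseteq> A + B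
    \<and> residue_count q A + residue_count q B \<le> residue_count q S + residue_count q (stab S)"
  using assms(2-)
proof (induction "residue_count q B" arbitrary: A B rule: less_induct)
  case less
  note A = less.prems(1) and B = less.prems(2)
  show ?case
  proof (cases "\<forall>e\<in>A. \<forall>b\<in>B. e + b \<in> A")
    case True
    then have "B \<subseteq> stab A" by (auto simp: stab_def)
    moreover have "A \<subseteq> A + B" using set_zero_plus2[OF less.prems(3), of A] by (simp only: add.commute)
    ultimately show ?thesis using A residue_count_mono by (intro exI[of _ A]) auto
  next
    case False
    then obtain e b where e: "e \<in> A" and b: "b \<in> B" "e + b \<notin> A" by auto
    \<comment> \<open>\<open>A\<close> receives what it lacks of \<open>e + B\<close>;
      \<open>B\<close> keeps the elements whose shifts by \<open>e\<close> already lie in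
      \<open>A\<close>.\<close>
    define A' where "A' = A \<union> (e +o B)"
    define B' where "B' = B \<inter> (- e +o A)"
    have per: "periodic q A'" "periodic q B'"
      unfolding A'_def B'_def using A B by (auto intro: periodic_Un periodic_Int periodic_translate)
    have "b \<notin> B'" using b by (auto simp: B'_def elt_set_plus_def)
    then have "B' \<subset> B" using b by (auto simp: B'_def)
    then have lt: "residue_count q B' < residue_count q B"
      using residue_count_psubset q per B by blast
    have "0 \<in> B'" using less.prems(3) e by (auto simp: B'_def elt_set_plus_def)
    moreover have "A' \<noteq> {}" using e by (auto simp: A'_def)
    ultimately obtain S where S: "periodic q S" "A' \<subseteq> S" "S \<subseteq> A' + B'"
      "residue_count q A' + residue_count q B' \<le> residue_count q S + residue_count q (stab S)"
      using less.hyps[OF lt per(1) per(2)] by blast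
    \<comment> \<open>So \<open>A'\<close> and \<open>B'\<close> have the sizes of the union and the
      intersection of \<open>A\<close> and \<open>e + B\<close>.\<close>
    have "e +o B' = A \<inter> (e +o B)"
      by (force simp: B'_def elt_set_plus_def)
    then have "residue_count q B' = residue_count q (A \<inter> (e +o B))"
      using residue_count_translate[OF q per(2), of e] by simp
    then have sum: "residue_count q A' + residue_count q B' = residue_count q A + residue_count q B"
      using residue_count_Un_Int[of q A "e +o B"] residue_count_translate[OF q B, of e]
      by (simp add: A'_def)
    have "A' + B' \<subseteq> A + B"
    proof
      fix z assume "z \<in> A' + B'"
      then obtain x y where xy: "z = x + y" "x \<in> A'" "y \<in> B'" by (auto elim: set_plus_elim)
      show "z \<in> A + B"
      proof (cases "x \<in> A")
        case True
        then show ?thesis using xy by (auto simp: B'_def)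
      next
        case False
        then obtain b' where b': "b' \<in> B" "x = e + b'" using xy by (auto simp: A'_def elt_set_plus_def)
        obtain a where a: "a \<in> A" "y = - e + a" using xy by (auto simp: B'_def elt_set_plus_def)
        have "z = a + b'" using xy a b' by simp
        then show ?thesis using a b' by (auto intro: set_plus_intro)
      qed
    qed
    then show ?thesis using S sum by (intro exI[of _ S]) (auto simp: A'_def)
  qed
qed

text \<open>Olson's inequality. With \<open>S\<close> from the previous lemma and
  \<open>H = stab S\<close>, the sumset has at least \<open>|A| + |B| - |H|\<close> and also at
  least \<open>|A| + |H|\<close> elements modulo \<open>q\<close>; adding the two bounds eliminates
  \<open>H\<close>.\<close>

lemma residue_count_sumset:
  assumes q: "q > 0" and A: "periodic q A" and B: "periodic q B" and "0 \<in> A" "0 \<in> B"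
    and gen: "\<And>d. (\<And>b. b \<in> B \<Longrightarrow> d dvd b) \<Longrightarrow> is_unit d"
    and ne: "A + B \<noteq> UNIV"
  shows "2 * residue_count q A + residue_count q B \<le> 2 * residue_count q (A + B)"
proof -
  obtain S where S: "periodic q S" "A \<subseteq> S" "S \<subseteq> A + B"
    and cS: "residue_count q A + residue_count q B \<le> residue_count q S + residue_count q (stab S)"
    using exists_periodic_between[OF q A B] assms by blast
  define H where "H = stab S"
  have H: "periodic q H" unfolding H_def using S periodic_stab by blast
  have AH: "A + H \<subseteq> S" using S by (auto simp: H_def stab_def elim!: set_plus_elim)
  have perAH: "periodic q (A + H)" using A periodic_sumset by blast
  obtain g where g: "g > 0" "stab (A + H) = {x. g dvd x}"
    using stab_eq_multiples[OF q perAH] by blast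
  \<comment> \<open>Otherwise the generator \<open>g\<close> divides all of \<open>B\<close>, so it
    is a unit, and \<open>A + H\<close>, hence also \<open>A + B\<close>, is everything.\<close>
  have "\<not> B \<subseteq> stab (A + H)"
  proof
    assume "B \<subseteq> stab (A + H)"
    then have "is_unit g" using gen[of g] g by auto
    then have all: "stab (A + H) = UNIV" using g by (auto intro: dvd_trans)
    have "0 + 0 \<in> A + H" using assms stab_0 by (intro set_plus_intro) (auto simp: H_def)
    then have z: "0 \<in> A + H" by simp
    have "\<forall>a\<in>A + H. a + x \<in> A + H" for x using all unfolding stab_def by blast
    then have "0 + x \<in> A + H" for x using z by blast
    then have "A + H = UNIV" by (simp add: set_eq_iff)
    then show False using AH S ne by auto
  qed
  then obtain b a h where abh: "b \<in> B" "a \<in> A" "h \<in> H" "a + h + b \<notin> A + H"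
    by (auto simp: stab_def elim!: set_plus_elim)
  \<comment> \<open>\<open>A + H\<close> is a union of cosets of \<open>H\<close>, so it misses the
    whole coset of \<open>a + b\<close>.\<close>
  have ab: "a + b + h' \<notin> A + H" if h': "h' \<in> H" for h'
  proof
    assume "a + b + h' \<in> A + H"
    then obtain a1 h1 where a1: "a1 \<in> A" "h1 \<in> H" "a + b + h' = a1 + h1" by (auto elim: set_plus_elim)
    have "h1 + (- h' + h) \<in> H"
      unfolding H_def using a1 h' abh by (intro stab_add stab_uminus[OF q S(1)]) (auto simp: H_def)
    then have "a1 + (h1 + (- h' + h)) \<in> A + H" using a1 by (intro set_plus_intro)
    moreover have "a1 + (h1 + (- h' + h)) = a + h + b" using a1 by simp
    ultimately show False using abh(4) by metis
  qed
  \<comment> \<open>\<open>b + A1\<close> lies in the sumset outside \<open>A + H\<close>, while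
    \<open>a + H\<close> without \<open>A1\<close> lies in \<open>A + H\<close> outside
    \<open>A\<close>. Whatever the size of \<open>A1\<close>, the two gains add up to
    \<open>|H|\<close>.\<close>
  define A1 where "A1 = A \<inter> (a +o H)"
  have A1: "periodic q A1" unfolding A1_def using A H by (intro periodic_Int periodic_translate)
  have disj: "(A + H) \<inter> (b +o A1) = {}"
  proof -
    have "b + z \<notin> A + H" if z: "z \<in> A1" for z
    proof -
      obtain h' where "h' \<in> H" "z = a + h'" using z by (auto simp: A1_def elt_set_plus_def)
      then show ?thesis using ab[of h'] by (simp add: ac_simps)
    qed
    then show ?thesis by (auto simp: elt_set_plus_def)
  qed
  have "(A + H) \<union> (b +o A1) \<subseteq> A + B"
  proof -
    have "b +o A1 \<subseteq> A + B"
      using abh by (auto simp: A1_def elt_set_plus_def add.commute[of b] intro!: set_plus_intro)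
    then show ?thesis using AH S by auto
  qed
  then have c1: "residue_count q (A + H) + residue_count q A1 \<le> residue_count q (A + B)"
    using residue_count_mono[of "(A + H) \<union> (b +o A1)" "A + B" q] residue_count_Un_Int[of q "A + H" "b +o A1"]
      disj residue_count_translate[OF q A1, of b] by (simp add: residue_count_def)
  have "A \<union> (a +o H) \<subseteq> A + H"
    using abh set_zero_plus2[of H A] stab_0[of S]
    by (auto simp: elt_set_plus_def H_def[symmetric] add.commute[of H])
  then have c2: "residue_count q A + residue_count q H \<le> residue_count q (A + H) + residue_count q A1"
    using residue_count_mono[of "A \<union> (a +o H)" "A + H" q] residue_count_Un_Int[of q A "a +o H"]
      residue_count_translate[OF q H, of a] by (simp add: A1_def)
  show ?thesis
    using c1 c2 cS residue_count_mono[OF S(3), of q] by (simp add: H_def)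
qed

section \<open>Iterated sumsets\<close>

fun nfold_sumset :: "nat \<Rightarrow> 'a::comm_monoid_add set \<Rightarrow> 'a set" where
  "nfold_sumset 0 E = {0}"
| "nfold_sumset (Suc h) E = nfold_sumset h E + E"

text \<open>By Olson's inequality each further summand gains half of \<open>|B|\<close> until all
  residues are reached.\<close>

lemma nfold_sumset_eq_UNIV:
  fixes B :: "int set"
  assumes q: "q > 0" and B: "periodic q B" and 0: "0 \<in> B"
    and gen: "\<And>d. (\<And>b. b \<in> B \<Longrightarrow> d dvd b) \<Longrightarrow> is_unit d"
    and h: "2 * nat q \<le> (Suc h) * residue_count q B" "h > 0"
  shows "nfold_sumset h B = UNIV"
proof -
  \<comment> \<open>The induction starts at one summand since \<open>{0}\<close> need not be
    periodic. The first copy of \<open>B\<close> counts in full and later ones by half, hence the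
    factor \<open>k + 2\<close>.\<close>
  have "periodic q (nfold_sumset (Suc k) B) \<and> 0 \<in> nfold_sumset (Suc k) B \<and>
    (nfold_sumset (Suc k) B = UNIV \<or> (k + 2) * residue_count q B \<le> 2 * residue_count q (nfold_sumset (Suc k) B))" for k
  proof (induction k)
    case 0
    have "{0} + B = B" by (auto simp: set_plus_def)
    then show ?case using B \<open>0 \<in> B\<close> by simp
  next
    case (Suc k)
    let ?A = "nfold_sumset (Suc k) B"
    have S: "nfold_sumset (Suc (Suc k)) B = ?A + B" by simp
    have per: "periodic q (?A + B)" using Suc periodic_sumset by blast
    have z: "0 \<in> ?A + B" using set_plus_intro[of 0 ?A 0 B] Suc \<open>0 \<in> B\<close> by simp
    have "?A \<subseteq> ?A + B" using set_zero_plus2[OF \<open>0 \<in> B\<close>, of ?A] by (simp only: add.commute)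
    then show ?case
      unfolding S
      using residue_count_sumset[OF q _ B _ \<open>0 \<in> B\<close> gen, of ?A] Suc per z
      by (cases "?A + B = UNIV") (auto simp del: nfold_sumset.simps)
  qed
  note * = this
  obtain k where k: "h = Suc k" using h by (cases h) auto
  show ?thesis
  proof (rule ccontr)
    assume "nfold_sumset h B \<noteq> UNIV"
    then show False
      using *[of k] h residue_count_lt[OF q, of "nfold_sumset h B"] unfolding k
      by (simp del: nfold_sumset.simps)
  qed
qed

text \<open>Growth is measured on the periodic hull of \<open>E\<close>; this returns to genuine
  sums of elements of \<open>E\<close>.\<close>

lemma nfold_sumset_cong_lift:
  assumes "x \<in> nfold_sumset h {x::int. \<exists>e\<in>E. [x = int e] (mod q)}"
  shows "\<exists>y\<in>nfold_sumset h E. [x = int y] (mod q)"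
  using assms
proof (induction h arbitrary: x)
  case 0
  then show ?case by simp
next
  case (Suc h)
  then obtain u v where uv: "x = u + v" "u \<in> nfold_sumset h {x. \<exists>e\<in>E. [x = int e] (mod q)}"
    "\<exists>e\<in>E. [v = int e] (mod q)" unfolding nfold_sumset.simps by (blast elim: set_plus_elim)
  then obtain y e where "y \<in> nfold_sumset h E" "[u = int y] (mod q)" "e \<in> E" "[v = int e] (mod q)"
    using Suc.IH by blast
  then show ?case using uv by (intro bexI[of _ "y + e"]) (auto intro: cong_add set_plus_intro)
qed

lemma nfold_sumset_le:
  fixes E :: "nat set"
  assumes "\<And>e. e \<in> E \<Longrightarrow> e \<le> q" "y \<in> nfold_sumset h E"
  shows "y \<le> h * q"
  using assms(2)
proof (induction h arbitrary: y)
  case (Suc h)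
  then obtain u v where "y = u + v" "u \<in> nfold_sumset h E" "v \<in> E" by (auto elim: set_plus_elim)
  then show ?case using Suc.IH[of u] assms(1)[of v] by simp
qed simp

text \<open>Each of the \<open>j\<close> extra summands is either \<open>q\<close> or the padding
  \<open>0\<close>.\<close>

lemma nfold_sumset_add_multiple:
  fixes E :: "nat set"
  assumes "0 \<in> E" "q \<in> E" "y \<in> nfold_sumset h E" "c \<le> j"
  shows "y + c * q \<in> nfold_sumset (h + j) E"
  using assms(4)
proof (induction j arbitrary: c)
  case 0
  then show ?case using assms by simp
next
  case (Suc j)
  show ?case
  proof (cases c)
    case 0
    then show ?thesis using Suc.IH[of 0] set_plus_intro[of y _ 0 E] assms by simp
  next
    case (Suc c')
    then have "(y + c' * q) + q \<in> nfold_sumset (Suc (h + j)) E"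
      using Suc.IH[of c'] Suc.prems assms by auto
    then show ?thesis using Suc by (simp add: add.commute add.left_commute)
  qed
qed

lemma nfold_sumset_affine:
  fixes E0 :: "nat set"
  assumes "\<And>e. e \<in> E0 \<Longrightarrow> a + g * e \<in> E" "y \<in> nfold_sumset k E0"
  shows "k * a + g * y \<in> nfold_sumset k E"
  using assms(2)
proof (induction k arbitrary: y)
  case (Suc k)
  then obtain u v where uv: "y = u + v" "u \<in> nfold_sumset k E0" "v \<in> E0" by (auto elim: set_plus_elim)
  have "(k * a + g * u) + (a + g * v) \<in> nfold_sumset (Suc k) E"
    using Suc.IH[OF uv(2)] assms(1)[OF uv(3)] by auto
  then show ?case using uv by (simp add: algebra_simps)
qed simp

text \<open>\<open>h\<close> summands give some \<open>y\<close> congruent to \<open>t\<close>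
  modulo \<open>q\<close> with \<open>y \<le> h * q \<le> t\<close>; at most \<open>j\<close> copies
  of \<open>q\<close> fill the gap.\<close>

lemma nfold_sumset_interval:
  fixes E :: "nat set"
  assumes E: "E \<subseteq> {0..q}" "0 \<in> E" "q \<in> E" "q > 0" "Gcd E = 1"
    and h: "h > 0" "2 * q \<le> Suc h * (card E - 1)" and t: "h * q \<le> t" "t \<le> j * q"
  shows "t \<in> nfold_sumset (h + j) E"
proof -
  define B where "B = {x::int. \<exists>e\<in>E. [x = int e] (mod int q)}"
  have per: "periodic (int q) B"
    by (rule periodicI) (auto simp: B_def cong_def)
  \<comment> \<open>\<open>0\<close> and \<open>q\<close> both lie in \<open>E\<close> but in the
    same class, so one residue is lost.\<close>
  have "B \<inter> {0..<int q} = int ` (E - {q})"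
  proof (intro equalityI subsetI)
    fix x assume x: "x \<in> B \<inter> {0..<int q}"
    then obtain e where e: "e \<in> E" "[x = int e] (mod int q)" by (auto simp: B_def)
    show "x \<in> int ` (E - {q})"
    proof (cases "e = q")
      case True
      then have "x = 0" using x e by (simp add: cong_def)
      then show ?thesis using E by (auto intro!: image_eqI[of _ _ 0])
    next
      case False
      then have "e < q" using e E by fastforce
      then have "x = int e" using x e by (simp add: cong_def)
      then show ?thesis using e False by auto
    qed
  next
    fix x assume "x \<in> int ` (E - {q})"
    then obtain e where "e \<in> E" "e \<noteq> q" "x = int e" by auto
    moreover then have "e < q" using E by fastforce
    ultimately show "x \<in> B \<inter> {0..<int q}" by (force simp: B_def)
  qed
  moreover have "card (int ` (E - {q})) = card E - 1" using E by (simp add: card_image)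
  ultimately have cB: "residue_count (int q) B = card E - 1" by (simp add: residue_count_def)
  have inB: "int e \<in> B" if "e \<in> E" for e unfolding B_def using that cong_refl by blast
  have gen: "is_unit d" if d: "\<And>b. b \<in> B \<Longrightarrow> d dvd b" for d
  proof -
    have "nat \<bar>d\<bar> dvd e" if "e \<in> E" for e using d[OF inB[OF that]] by (simp add: nat_abs_dvd_iff)
    then have "nat \<bar>d\<bar> dvd Gcd E" by (rule Gcd_greatest)
    then show ?thesis using E by simp
  qed
  have "nfold_sumset h B = UNIV"
    using inB[OF E(2)] E h cB by (intro nfold_sumset_eq_UNIV[OF _ per _ gen]) auto
  then obtain y where y: "y \<in> nfold_sumset h E" "[int t = int y] (mod int q)"
    using nfold_sumset_cong_lift[of "int t" h E "int q"] by (auto simp: B_def)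
  have "y \<le> h * q" by (rule nfold_sumset_le[OF _ y(1)]) (use E in auto)
  then have le: "y \<le> t" using t by simp
  have "int q dvd int (t - y)" using y(2) le by (simp add: cong_iff_dvd_diff of_nat_diff)
  then have "q dvd t - y" by simp
  then obtain c where "t - y = q * c" by (rule dvdE)
  then have c: "t = y + c * q" using le by (simp add: mult.commute)
  then have "c * q \<le> j * q" using t by linarith
  then have "c \<le> j" using E by simp
  then show ?thesis using nfold_sumset_add_multiple[of E q y h c j] E y c by simp
qed

text \<open>Subtracting the minimum and dividing by the gcd \<open>g\<close> of the differences
  makes \<open>nfold_sumset_interval\<close> applicable; undoing this turns its interval into a
  progression of step \<open>g\<close>. The normalised set lies in \<open>{0..q}\<close>, whence
  \<open>card E - 1 \<le> q\<close>.\<close>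

lemma nfold_sumset_progression:
  fixes E :: "nat set"
  assumes fin: "finite E" and card: "card E \<ge> 2"
  obtains g q where "g > 0" "q > 0" "g * q = Max E - Min E" "card E - 1 \<le> q"
    "\<And>h j t. h > 0 \<Longrightarrow> 2 * q \<le> Suc h * (card E - 1) \<Longrightarrow> h * q \<le> t \<Longrightarrow> t \<le> j * q
      \<Longrightarrow> (h + j) * Min E + g * t \<in> nfold_sumset (h + j) E"
proof -
  have ne: "E \<noteq> {}" using card by auto
  define a where "a = Min E"
  have a: "a \<in> E" "\<And>e. e \<in> E \<Longrightarrow> a \<le> e" using fin ne by (auto simp: a_def)
  define F where "F = (\<lambda>e. e - a) ` E"
  define g where "g = Gcd F"
  have M: "Max E \<in> E" "\<And>e. e \<in> E \<Longrightarrow> e \<le> Max E" using fin ne by auto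
  have "a \<noteq> Max E"
  proof
    assume "a = Max E"
    then have "E \<subseteq> {a}" using a M by (auto intro: antisym)
    then have "card E \<le> 1" using card_mono[of "{a}" E] by simp
    then show False using card by simp
  qed
  then have lt: "a < Max E" using a M by (simp add: order_less_le)
  have dvd: "g dvd e - a" if "e \<in> E" for e unfolding g_def F_def using that by (intro Gcd_dvd) auto
  have g0: "g > 0"
  proof (rule ccontr)
    assume "\<not> g > 0"
    then show False using dvd[OF M(1)] lt by simp
  qed
  define q where "q = (Max E - a) div g"
  have gq: "g * q = Max E - a" using dvd[OF M(1)] by (simp add: q_def)
  then have q0: "q > 0" using lt by (intro Nat.gr0I) auto
  define E0 where "E0 = (\<lambda>e. (e - a) div g) ` E"
  have recover: "a + g * ((e - a) div g) = e" if "e \<in> E" for e using dvd[OF that] a(2)[OF that] by simp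
  have "inj_on (\<lambda>e. (e - a) div g) E" by (rule inj_onI) (metis recover)
  then have cE0: "card E0 = card E" by (simp add: E0_def card_image)
  have E0q: "E0 \<subseteq> {0..q}"
    unfolding E0_def q_def using M by (auto intro!: div_le_mono diff_le_mono)
  have "0 \<in> E0" using a by (force simp: E0_def)
  moreover have "q \<in> E0" using M by (auto simp: E0_def q_def)
  moreover have "Gcd E0 = 1"
  proof -
    have "g * Gcd E0 dvd f" if f: "f \<in> F" for f
    proof -
      obtain e where e: "e \<in> E" "f = e - a" using f by (auto simp: F_def)
      have "Gcd E0 dvd (e - a) div g" using e by (auto simp: E0_def)
      then have "g * Gcd E0 dvd g * ((e - a) div g)" by (rule mult_dvd_mono[OF dvd_refl])
      then show ?thesis using e dvd by simp
    qed
    then have "g * Gcd E0 dvd g" unfolding g_def by (rule Gcd_greatest)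
    then show ?thesis using g0 by simp
  qed
  ultimately have int: "t \<in> nfold_sumset (h + j) E0"
    if "h > 0" "2 * q \<le> Suc h * (card E - 1)" "h * q \<le> t" "t \<le> j * q" for h j t
    using nfold_sumset_interval[OF E0q _ _ q0] that cE0 by auto
  have "card (E0 - {0}) \<le> card {1..q}" using E0q by (intro card_mono) force+
  then have "card E - 1 \<le> q" using \<open>0 \<in> E0\<close> cE0 by (simp add: card_Diff_singleton)
  moreover have "(h + j) * a + g * t \<in> nfold_sumset (h + j) E"
    if "h > 0" "2 * q \<le> Suc h * (card E - 1)" "h * q \<le> t" "t \<le> j * q" for h j t
    by (rule nfold_sumset_affine[OF _ int[OF that]]) (auto simp: E0_def recover)
  ultimately show ?thesis using that g0 q0 gq unfolding a_def by blast
qed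

section \<open>Harmonic pigeonhole\<close>

lemma harmonic_sum_le_log:
  assumes "N > 0"
  shows "(\<Sum>r=1..N. 1 / real r) \<le> log 2 (2 * real N)"
  using assms
proof (induction N rule: nat_induct_non_zero)
  case 1
  then show ?case by simp
next
  case (Suc N)
  have "ln (real N / real (Suc N)) \<le> real N / real (Suc N) - 1"
    using Suc by (intro ln_le_minus_one) auto
  also have "\<dots> = - 1 / real (Suc N)" by (simp add: field_simps)
  finally have "1 / real (Suc N) \<le> ln (real (Suc N)) - ln (real N)"
    using Suc by (simp add: ln_div)
  also have "\<dots> \<le> (ln (real (Suc N)) - ln (real N)) / ln 2"
    using Suc ln_2_less_1 by (simp add: le_divide_eq_1_pos divide_simps mult_left_le)
  also have "\<dots> = log 2 (2 * real (Suc N)) - log 2 (2 * real N)"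
    using Suc by (simp add: log_mult log_def[of 2 "real _"] log_def[of 2 "1 + real _"] diff_divide_distrib del: of_nat_Suc)
  finally show ?case using Suc by simp
qed

text \<open>If every \<open>r * f r\<close> were too small, summing against the harmonic series
  would put the total below itself. Single values of \<open>f\<close> may be negative, which the
  application to pair sums uses.\<close>

lemma harmonic_pigeonhole:
  fixes f :: "nat \<Rightarrow> real"
  assumes "N > 0" and nonneg: "0 \<le> (\<Sum>r=1..N. f r)"
  obtains r where "r \<in> {1..N}" "(\<Sum>r=1..N. f r) \<le> real r * f r * log 2 (2 * real N)"
proof -
  define T where "T = (\<Sum>r=1..N. f r)"
  define l where "l = log 2 (2 * real N)"
  have l: "l \<ge> 1" using assms by (simp add: l_def log_mult)
  have "\<exists>r\<in>{1..N}. T \<le> real r * f r * l"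
  proof (rule ccontr)
    assume "\<not> ?thesis"
    then have "f r < (T / l) * (1 / real r)" if "r \<in> {1..N}" for r
      using that l by (auto simp: field_simps not_le)
    then have "T < (\<Sum>r=1..N. (T / l) * (1 / real r))"
      unfolding T_def using assms by (intro sum_strict_mono) (auto simp: T_def)
    also have "\<dots> = (T / l) * (\<Sum>r=1..N. 1 / real r)" by (simp add: sum_distrib_left)
    also have "\<dots> \<le> (T / l) * l"
      using harmonic_sum_le_log[OF assms(1)] nonneg l by (intro mult_left_mono) (auto simp: l_def T_def)
    finally show False using l by simp
  qed
  then show ?thesis using that unfolding T_def l_def by blast
qed

text \<open>Layer-cake summation: \<open>f s\<close> is the number of thresholds it reaches.\<close>

lemma sum_eq_sum_card_superlevel:
  fixes f :: "'a \<Rightarrow> nat"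
  assumes "finite S" "\<And>s. s \<in> S \<Longrightarrow> f s \<le> N"
  shows "(\<Sum>s\<in>S. f s) = (\<Sum>k=1..N. card {s \<in> S. k \<le> f s})"
proof -
  have "f s = (\<Sum>k=1..N. if k \<le> f s then 1 else 0)" if "s \<in> S" for s
  proof -
    have "{1..N} \<inter> {k. k \<le> f s} = {1..f s}" using assms(2)[OF that] by auto
    then show ?thesis by (simp add: sum.If_cases)
  qed
  then have "(\<Sum>s\<in>S. f s) = (\<Sum>s\<in>S. \<Sum>k=1..N. if k \<le> f s then 1 else 0)" by (rule sum.cong[OF refl])
  also have "\<dots> = (\<Sum>k=1..N. \<Sum>s\<in>S. if k \<le> f s then 1 else 0)" by (rule sum.swap)
  also have "\<dots> = (\<Sum>k=1..N. card {s \<in> S. k \<le> f s})"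
    using assms(1) by (simp add: sum.If_cases Int_def)
  finally show ?thesis .
qed

lemma popular_multiplicity:
  assumes "Z \<noteq> {#}" "\<And>x. count Z x \<le> \<mu>"
  obtains K where "K \<in> {1..\<mu>}"
    "real (size Z) \<le> real K * real (card {x \<in> set_mset Z. K \<le> count Z x}) * log 2 (2 * real \<mu>)"
proof -
  obtain x where "x \<in># Z" using assms by auto
  then have "count Z x > 0" by (rule count_greater_zero_iff[THEN iffD2])
  then have mu: "\<mu> > 0" using assms(2)[of x] by linarith
  have "size Z = (\<Sum>k=1..\<mu>. card {x \<in> set_mset Z. k \<le> count Z x})"
    unfolding size_multiset_overloaded_eq using assms by (intro sum_eq_sum_card_superlevel) auto
  then have "real (size Z) = (\<Sum>k=1..\<mu>. real (card {x \<in> set_mset Z. k \<le> count Z x}))" by simp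
  then show ?thesis
    using harmonic_pigeonhole[OF mu, of "\<lambda>k. real (card {x \<in> set_mset Z. k \<le> count Z x})"] that by auto
qed

text \<open>Only first entries are recorded; the second is determined as \<open>s - x\<close>, so
  the cardinality is the number of ordered representations.\<close>

definition pair_reps :: "nat set \<Rightarrow> nat \<Rightarrow> nat set" where
  "pair_reps D s = {x \<in> D. \<exists>y\<in>D. x + y = s}"

text \<open>Subtracting \<open>v / 2\<close> from the level set sizes before pigeonholing
  keeps the chosen level set of size at least \<open>v / 2\<close>, so that only its product
  with the number of representations loses a logarithm.\<close>

lemma popular_pair_sums:
  fixes D :: "nat set"
  assumes fin: "finite D" and "D \<noteq> {}"
  defines "v \<equiv> card D"
  obtains r E where "E \<subseteq> D + D" "v < 2 * card E" "\<And>s. s \<in> E \<Longrightarrow> r \<le> card (pair_reps D s)"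
    "(real v)\<^sup>2 \<le> 2 * real r * real (card E) * log 2 (2 * real v)"
proof -
  have v: "v > 0" using assms by (simp add: v_def card_gt_0_iff)
  have fS: "finite (D + D)" using fin by (simp add: finite_set_plus)
  have "v * v = card (D \<times> D)" by (simp add: v_def card_cartesian_product)
  also have "D \<times> D = (\<Union>s\<in>D + D. {p \<in> D \<times> D. fst p + snd p = s})" by auto
  also have "card \<dots> = (\<Sum>s\<in>D + D. card {p \<in> D \<times> D. fst p + snd p = s})"
    using fin fS by (intro card_UN_disjoint) auto
  also have "\<dots> = (\<Sum>s\<in>D + D. card (pair_reps D s))"
  proof (rule sum.cong[OF refl])
    fix s
    have "pair_reps D s = fst ` {p \<in> D \<times> D. fst p + snd p = s}"
      by (force simp: pair_reps_def)
    moreover have "inj_on fst {p \<in> D \<times> D. fst p + snd p = s}" by (auto intro!: inj_onI)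
    ultimately show "card {p \<in> D \<times> D. fst p + snd p = s} = card (pair_reps D s)"
      by (simp add: card_image)
  qed
  also have "\<dots> = (\<Sum>k=1..v. card {s \<in> D + D. k \<le> card (pair_reps D s)})"
    unfolding v_def by (intro sum_eq_sum_card_superlevel fS card_mono fin) (auto simp: pair_reps_def)
  finally have "v * v = (\<Sum>k=1..v. card {s \<in> D + D. k \<le> card (pair_reps D s)})" .
  from arg_cong[OF this, of real]
  have eq: "(\<Sum>k=1..v. real (card {s \<in> D + D. k \<le> card (pair_reps D s)})) = real v * real v"
    by (simp only: of_nat_mult of_nat_sum)
  define f where "f k = real (card {s \<in> D + D. k \<le> card (pair_reps D s)}) - real v / 2" for k
  \<comment> \<open>The \<open>v\<close> shifts by \<open>v / 2\<close> remove exactly half of the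
    total \<open>v\<^sup>2\<close>.\<close>
  have sum: "(\<Sum>k=1..v. f k) = (real v)\<^sup>2 / 2"
    by (simp add: f_def sum_subtractf eq[unfolded One_nat_def] power2_eq_square)
  then obtain r where r: "r \<in> {1..v}" "(real v)\<^sup>2 / 2 \<le> real r * f r * log 2 (2 * real v)"
    using harmonic_pigeonhole[OF v, of f] by (metis divide_nonneg_pos zero_le_power2 zero_less_numeral)
  define E where "E = {s \<in> D + D. r \<le> card (pair_reps D s)}"
  have fr: "f r = real (card E) - real v / 2" by (simp add: f_def E_def)
  have l: "log 2 (2 * real v) > 0" using v by (simp add: log_mult add_pos_nonneg)
  have rl: "real r * log 2 (2 * real v) > 0" using l r by simp
  have "0 < (real v)\<^sup>2 / 2" using v by simp
  then have "0 < real r * f r * log 2 (2 * real v)" using r(2) by linarith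
  then have "0 < (real r * log 2 (2 * real v)) * f r" by (simp only: mult_ac)
  then have "f r > 0" using rl by (simp add: zero_less_mult_iff)
  then have "v < 2 * card E" using fr by simp
  moreover have "(real v)\<^sup>2 \<le> 2 * real r * real (card E) * log 2 (2 * real v)"
  proof -
    have "real r * log 2 (2 * real v) * f r \<le> real r * log 2 (2 * real v) * real (card E)"
      using rl fr by (intro mult_left_mono) auto
    also have "real r * log 2 (2 * real v) * f r = real r * f r * log 2 (2 * real v)" by simp
    finally show ?thesis using r(2) by (simp add: mult_ac)
  qed
  moreover have "E \<subseteq> D + D" "\<And>s. s \<in> E \<Longrightarrow> r \<le> card (pair_reps D s)" by (simp_all add: E_def)
  ultimately show ?thesis using that by blast
qed

section \<open>Subset sums of a set with repetitions\<close>

text \<open>Greedy choice: each summand from \<open>E\<close> is split into two elements of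
  \<open>D\<close>, avoiding those whose \<open>K\<close> copies are nearly used up. After
  \<open>k'\<close> splittings only \<open>2 * k'\<close> copies are gone, so few elements are
  exhausted, and each spoils at most two representations.\<close>

lemma nfold_pair_sums_subset_sums:
  fixes D E :: "nat set"
  assumes fin: "finite D" and K: "K > 0"
    and reps: "\<And>s. s \<in> E \<Longrightarrow> r \<le> card (pair_reps D s)"
    and rK: "8 * k \<le> r * K" and t: "t \<in> nfold_sumset k E"
  shows "t \<in> subset_sums (repeat_mset K (mset_set D))"
proof -
  let ?A = "repeat_mset K (mset_set D)"
  have "\<exists>Y. Y \<subseteq># ?A \<and> size Y = 2 * k' \<and> \<Sum>\<^sub># Y = t" if "k' \<le> k" "t \<in> nfold_sumset k' E" for k' t
    using that
  proof (induction k' arbitrary: t)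
    case 0
    then show ?case by (intro exI[of _ "{#}"]) auto
  next
    case (Suc k')
    then obtain u s where us: "t = u + s" "u \<in> nfold_sumset k' E" "s \<in> E" by (auto elim: set_plus_elim)
    then obtain Y where Y: "Y \<subseteq># ?A" "size Y = 2 * k'" "\<Sum>\<^sub># Y = u"
      using Suc.IH[of u] Suc.prems by auto
    have countY: "c * card {x \<in> D. c \<le> count Y x} \<le> 2 * k'" for c
    proof -
      have "x \<in># mset_set D" if "x \<in># Y" for x
        using mset_subset_eqD[OF Y(1) that] by (simp add: count_greater_zero_iff[symmetric] del: count_greater_zero_iff)
      then have sub: "set_mset Y \<subseteq> D" using fin by auto
      have "c * card {x \<in> D. c \<le> count Y x} = (\<Sum>x\<in>{x \<in> D. c \<le> count Y x}. c)" by simp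
      also have "\<dots> \<le> (\<Sum>x\<in>{x \<in> D. c \<le> count Y x}. count Y x)" by (intro sum_mono) auto
      also have "\<dots> \<le> (\<Sum>x\<in>D. count Y x)" using fin by (intro sum_mono2) auto
      also have "\<dots> = (\<Sum>x\<in>set_mset Y. count Y x)"
        using fin sub by (intro sum.mono_neutral_right) (auto simp: not_in_iff)
      also have "\<dots> = 2 * k'" using Y(2) by (simp add: size_multiset_overloaded_eq)
      finally show ?thesis .
    qed
    \<comment> \<open>An element of \<open>Bad\<close> can occur as first or as second entry, hence
      the factor 2; \<open>W\<close> restricts first entries only and serves to exclude the diagonal
      pair.\<close>
    have avoid: "\<exists>x y. x \<in> D \<and> y \<in> D \<and> x + y = s \<and> x \<notin> Bad \<and> y \<notin> Bad \<and> x \<notin> W"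
      if "Bad \<subseteq> D" "finite W" "2 * card Bad + card W < r" for Bad W
    proof (rule ccontr)
      assume no: "\<not> ?thesis"
      have fB: "finite Bad" using that(1) fin by (rule finite_subset)
      have "pair_reps D s \<subseteq> Bad \<union> ((\<lambda>y. s - y) ` Bad) \<union> W"
      proof
        fix x assume "x \<in> pair_reps D s"
        then obtain y where y: "x \<in> D" "y \<in> D" "x + y = s" by (auto simp: pair_reps_def)
        then have "x \<in> Bad \<or> y \<in> Bad \<or> x \<in> W" using no by blast
        moreover have "x = s - y" using y by simp
        ultimately show "x \<in> Bad \<union> ((\<lambda>y. s - y) ` Bad) \<union> W" by blast
      qed
      then have "card (pair_reps D s) \<le> card (Bad \<union> ((\<lambda>y. s - y) ` Bad) \<union> W)"
        using fB that by (intro card_mono) auto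
      also have "\<dots> \<le> card Bad + card ((\<lambda>y. s - y) ` Bad) + card W"
        by (meson add_le_mono card_Un_le le_refl order_trans)
      also have "\<dots> \<le> card Bad + card Bad + card W" using card_image_le[OF fB] by simp
      finally show False using that reps[OF us(3)] by simp
    qed
    have "\<exists>x y. x \<in> D \<and> y \<in> D \<and> x + y = s \<and> Y + {#x, y#} \<subseteq># ?A"
    \<comment> \<open>A pair with \<open>x = y\<close> consumes two copies. For \<open>K = 1\<close>
      it is forbidden through \<open>s div 2\<close>; for larger \<open>K\<close> the threshold
      \<open>K - 1\<close> leaves room for both copies.\<close>
    proof (cases "K = 1")
      case True
      let ?Bad = "{x \<in> D. 1 \<le> count Y x}"
      have "2 * card ?Bad + card {s div 2} < r" using countY[of 1] rK True Suc.prems by simp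
      then obtain x y where xy: "x \<in> D" "y \<in> D" "x + y = s" "x \<notin> ?Bad" "y \<notin> ?Bad" "x \<noteq> s div 2"
        using avoid[of ?Bad "{s div 2}"] by auto
      moreover have "x \<noteq> y" using xy by auto
      moreover have "count Y x = 0" "count Y y = 0" using xy by (auto simp: not_in_iff)
      ultimately have "Y + {#x, y#} \<subseteq># ?A"
        using mset_subset_eqD Y(1) fin True by (auto simp: subseteq_mset_def)
      then show ?thesis using xy by blast
    next
      case False
      let ?Bad = "{x \<in> D. K - 1 \<le> count Y x}"
      \<comment> \<open>The 8 in the hypothesis is a product of three doublings: two copies per
        splitting, \<open>K \<le> 2 * (K - 1)\<close>, and two entries per pair.\<close>
      have "K * card ?Bad \<le> (2 * (K - 1)) * card ?Bad" using False K by (intro mult_right_mono) auto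
      also have "\<dots> \<le> 4 * k'" using countY[of "K - 1"] by simp
      finally have "2 * (K * card ?Bad) < r * K" using rK Suc.prems(1) by linarith
      then have "K * (2 * card ?Bad) < K * r" by (simp only: mult.commute mult.left_commute)
      then have "2 * card ?Bad + card ({} :: nat set) < r" by simp
      then obtain x y where xy: "x \<in> D" "y \<in> D" "x + y = s" "x \<notin> ?Bad" "y \<notin> ?Bad"
        using avoid[of ?Bad "{}"] by auto
      then have "count Y x + 2 \<le> K" "count Y y + 2 \<le> K" using False K by auto
      then have "Y + {#x, y#} \<subseteq># ?A"
        using Y(1) fin xy by (auto simp: subseteq_mset_def)
      then show ?thesis using xy by blast
    qed
    then obtain x y where xy: "x + y = s" "Y + {#x, y#} \<subseteq># ?A" by blast
    then show ?case using Y us by (intro exI[of _ "Y + {#x, y#}"]) auto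
  qed
  then show ?thesis using t unfolding subset_sums_def by blast
qed

text \<open>The popular sums \<open>E\<close> have a progression in their \<open>k\<close>-fold
  sumset, and popularity lets its terms be split within \<open>K\<close> copies of \<open>D\<close>.
  The step \<open>g\<close> is small because \<open>g * q \<le> 2 * M\<close>, while
  \<open>q \<ge> card E - 1\<close> and \<open>E\<close> has more than half as many elements as
  \<open>D\<close>.\<close>

lemma subset_sums_long_progression:
  fixes D :: "nat set"
  assumes fin: "finite D" and ne: "D \<noteq> {}" and pos: "\<And>x. x \<in> D \<Longrightarrow> 0 < x" and M: "\<And>x. x \<in> D \<Longrightarrow> x \<le> M"
    and Mm: "M \<le> m" and K: "K > 0"
    and dense: "512 * real m * log 2 (2 * real (card D)) \<le> (real (card D))\<^sup>2 * real K"
  obtains a d where "d > 0" "d * card D \<le> 8 * M" "a * card D \<le> 256 * M * m"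
    "\<And>y. y \<le> 2 * m \<Longrightarrow> a + d * y \<in> subset_sums (repeat_mset K (mset_set D))"
proof (cases "card D = 1")
  case True
  then obtain x where x: "D = {x}" by (rule card_1_singletonE)
  \<comment> \<open>For a singleton the density reads \<open>512 * m \<le> K\<close>, and the
    multiples of its element form the progression.\<close>
  have "2 * m \<le> K" using dense True by simp
  then have "0 + x * y \<in> subset_sums (repeat_mset K (mset_set D))" if "y \<le> 2 * m" for y
    unfolding subset_sums_def using that
    by (intro CollectI exI[of _ "replicate_mset y x"]) (auto simp: x sum_mset_replicate_mset subseteq_mset_def)
  then show ?thesis using that[of x 0] pos[of x] M[of x] x by simp
next
  case False
  define v where "v = card D"
  have "v > 0" using fin ne by (simp add: v_def card_gt_0_iff)
  then have v: "v \<ge> 2" using False by (simp add: v_def)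
  obtain r E where E: "E \<subseteq> D + D" "v < 2 * card E"
    and reps: "\<And>s. s \<in> E \<Longrightarrow> r \<le> card (pair_reps D s)"
    and vr: "(real v)\<^sup>2 \<le> 2 * real r * real (card E) * log 2 (2 * real v)"
    unfolding v_def using popular_pair_sums[OF fin ne] by metis
  define i where "i = card E"
  have fE: "finite E" using E fin finite_set_plus finite_subset by metis
  have i: "i \<ge> 2" using E v by (simp add: i_def)
  have E2M: "e \<le> 2 * M" if e: "e \<in> E" for e
  proof -
    obtain x y where "e = x + y" "x \<in> D" "y \<in> D" using set_plus_elim[OF subsetD[OF E(1) e]] by metis
    then show ?thesis using M[of x] M[of y] by simp
  qed
  obtain g q where g: "g > 0" and q: "q > 0" and gq: "g * q = Max E - Min E" and iq: "i - 1 \<le> q"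
    and prog: "\<And>h j t. h > 0 \<Longrightarrow> 2 * q \<le> Suc h * (i - 1) \<Longrightarrow> h * q \<le> t \<Longrightarrow> t \<le> j * q
      \<Longrightarrow> (h + j) * Min E + g * t \<in> nfold_sumset (h + j) E"
    using nfold_sumset_progression[OF fE] i unfolding i_def by metis
  have "E \<noteq> {}" using i by (auto simp: i_def)
  then have MinE: "Min E \<le> 2 * M" and MaxE: "Max E \<le> 2 * M" using fE E2M by auto
  have gq2: "g * q \<le> 2 * M" using gq MaxE by simp
  then have q2: "q \<le> 2 * M" using g by (metis le_trans mult_le_mono1 nat_mult_1 Suc_leI One_nat_def)
  \<comment> \<open>\<open>h\<close> summands reach every residue modulo \<open>q\<close>; the other
    \<open>h + c\<close> supply enough copies of \<open>q\<close> to run from \<open>h * q\<close>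
    to \<open>h * q + 2 * m\<close>.\<close>
  define h where "h = 2 * q div (i - 1) + 1"
  define c where "c = 2 * m div q + 1"
  define k where "k = h + (h + c)"
  have h0: "h > 0" by (simp add: h_def)
  have cover: "2 * q \<le> Suc h * (i - 1)"
  proof -
    have "2 * q < h * (i - 1)" using i dividend_less_div_times[of "i - 1" "2 * q"] by (simp add: h_def algebra_simps)
    also have "\<dots> \<le> Suc h * (i - 1)" by simp
    finally show ?thesis by simp
  qed
  have cq: "2 * m \<le> c * q"
    using q dividend_less_div_times[of q "2 * m"] by (simp add: c_def algebra_simps)
  have "h * (i - 1) \<le> 2 * q + (i - 1)" unfolding h_def by (simp only: add_mult_distrib) simp
  moreover have "c * (i - 1) \<le> 2 * m + (i - 1)"
  proof -
    have "2 * m div q * (i - 1) \<le> 2 * m div q * q" using iq by simp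
    also have "\<dots> \<le> 2 * m" by simp
    finally show ?thesis by (simp add: c_def)
  qed
  \<comment> \<open>Twice \<open>3 * q\<close> for \<open>h\<close> and \<open>2 * m + q\<close> for
    \<open>c\<close> make \<open>7 * q + 2 * m\<close>, and
    \<open>q \<le> 2 * M \<le> 2 * m\<close>.\<close>
  ultimately have "k * (i - 1) \<le> 16 * m" using iq q2 Mm by (simp add: k_def algebra_simps)
  moreover have "k * i \<le> k * (2 * (i - 1))" using i by (intro mult_le_mono2) simp
  then have "k * i \<le> 2 * (k * (i - 1))" by (simp only: mult.left_commute)
  ultimately have ki: "k * i \<le> 32 * m" by linarith
  define l where "l = log 2 (2 * real v)"
  have l: "l > 0" using v by (simp add: l_def log_mult add_pos_nonneg)
  have "512 * real m * l \<le> (2 * real r * real i * l) * real K"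
    using dense mult_right_mono[OF vr, of "real K"] unfolding v_def l_def i_def by linarith
  also have "\<dots> = 2 * (l * (real r * real i * real K))" by simp
  also have "512 * real m * l = 2 * (l * (256 * real m))" by simp
  finally have "l * (256 * real m) \<le> l * (real r * real i * real K)" by linarith
  then have "256 * real m \<le> real r * real i * real K" using l by simp
  then have "real (256 * m) \<le> real (r * i * K)" by simp
  then have "256 * m \<le> r * i * K" by (simp only: of_nat_le_iff)
  then have "8 * (k * i) \<le> r * i * K" using ki by linarith
  then have "i * (8 * k) \<le> i * (r * K)" by (simp only: mult_ac)
  then have rK: "8 * k \<le> r * K" using i by simp
  define a where "a = k * Min E + g * (h * q)"
  have "a + g * y \<in> subset_sums (repeat_mset K (mset_set D))" if y: "y \<le> 2 * m" for y
  proof -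
    have "(h + (h + c)) * Min E + g * (h * q + y) \<in> nfold_sumset (h + (h + c)) E"
      by (rule prog[OF h0 cover]) (use y cq in \<open>simp_all add: algebra_simps\<close>)
    then show ?thesis
      using nfold_pair_sums_subset_sums[OF fin K reps rK] by (simp add: a_def k_def algebra_simps)
  qed
  moreover have "g * v \<le> 8 * M"
  proof -
    have "v \<le> 4 * (i - 1)" using E v by (simp add: i_def)
    then have "g * v \<le> g * (4 * q)" using iq by (intro mult_le_mono2) simp
    then have "g * v \<le> 4 * (g * q)" by (simp only: mult.left_commute)
    then show ?thesis using gq2 by linarith
  qed
  moreover have "a * v \<le> 256 * M * m"
  proof -
    have "h * (g * q) \<le> k * (2 * M)" by (rule mult_le_mono[OF _ gq2]) (simp add: k_def)
    moreover have "k * Min E \<le> k * (2 * M)" using MinE by simp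
    ultimately have "k * Min E + h * (g * q) \<le> k * (2 * M) + k * (2 * M)" by linarith
    also have "k * Min E + h * (g * q) = a" by (simp add: a_def)
    finally have "a \<le> 4 * M * k" by (simp add: mult_ac)
    then have "a * v \<le> (4 * M * k) * (2 * i)" by (rule mult_le_mono) (use E in \<open>simp add: i_def\<close>)
    also have "\<dots> = 8 * M * (k * i)" by simp
    also have "\<dots> \<le> 8 * M * (32 * m)" using ki by (intro mult_le_mono2)
    finally show ?thesis by simp
  qed
  ultimately show ?thesis using that g by (simp add: v_def)
qed

section \<open>Covering all residues\<close>

lemma subset_sums_cover_residues:
  fixes R :: "nat multiset"
  assumes d: "d > 0" and nd: "\<And>p. prime p \<Longrightarrow> d \<le> size {#x \<in># R. \<not> p dvd x#}"
  obtains Y where "Y \<subseteq># R" "size Y < d" "[\<Sum>\<^sub># Y = r] (mod d)"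
proof -
  define T where "T Y = {x::int. \<exists>Z. Z \<subseteq># Y \<and> [x = int (\<Sum>\<^sub># Z)] (mod int d)}" for Y :: "nat multiset"
  have per: "periodic (int d) (T Y)" for Y
    by (rule periodicI) (auto simp: T_def cong_def)
  have zero: "0 \<in> T Y" for Y unfolding T_def by (auto intro!: exI[of _ "{#}"])
  define good where "good Y \<longleftrightarrow> Y \<subseteq># R \<and> size Y < residue_count (int d) (T Y)" for Y
  have d': "int d > 0" using d by simp
  \<comment> \<open>The empty sum already provides one residue; this keeps the inequality strict and
    the final size below \<open>d\<close>.\<close>
  have "good {#}" using residue_count_pos[OF d' per] zero by (auto simp: good_def)
  moreover have "size Y < d" if "good Y" for Y
    using that residue_count_le[of "int d" "T Y"] by (auto simp: good_def)
  ultimately obtain Y where Y: "good Y" and max: "\<And>Y'. good Y' \<Longrightarrow> size Y' \<le> size Y"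
    using ex_has_greatest_nat[of good "{#}" size d] by (metis less_imp_le)
  have "T Y = UNIV"
  proof (rule ccontr)
    assume ne: "T Y \<noteq> UNIV"
    obtain g where g: "g > 0" "stab (T Y) = {x. g dvd x}"
      using stab_eq_multiples[OF d' per] by blast
    have "g \<noteq> 1"
    proof
      assume "g = 1"
      then have all: "x \<in> stab (T Y)" for x using g by simp
      have "x \<in> T Y" for x using all[of x] zero[of Y] unfolding stab_def by force
      then show False using ne by blast
    qed
    then have "nat g \<noteq> 1" using g by linarith
    then obtain p where p: "prime p" "p dvd nat g" using prime_factor_nat by blast
    have "{#x \<in># R. \<not> p dvd x#} \<subseteq># Y"
    proof (rule ccontr)
      assume "\<not> ?thesis"
      then obtain x where x: "count Y x < count {#x \<in># R. \<not> p dvd x#} x"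
        by (auto simp: subseteq_mset_def not_le)
      then have px: "\<not> p dvd x" and cx: "count Y x < count R x" by (auto split: if_splits)
      have "int x \<notin> stab (T Y)"
      proof
        assume "int x \<in> stab (T Y)"
        then have "g dvd int x" using g by simp
        moreover have "int p dvd g" using p g by (metis int_dvd_int_iff int_nat_eq less_imp_le)
        ultimately have "int p dvd int x" by (rule dvd_trans[rotated])
        then show False using px by simp
      qed
      then obtain z where z: "z \<in> T Y" "z + int x \<notin> T Y" by (auto simp: stab_def)
      have sub: "T Y \<subseteq> T (add_mset x Y)"
        unfolding T_def using subset_mset.order_trans[of _ Y "add_mset x Y"] mset_subset_eq_add_right[of Y "{#x#}"]
        by (auto simp del: of_nat_sum_mset)
      obtain Z where Z: "Z \<subseteq># Y" "[z = int (\<Sum>\<^sub># Z)] (mod int d)" using z by (auto simp: T_def)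
      have "[z + int x = int (\<Sum>\<^sub># (add_mset x Z))] (mod int d)"
        using cong_add[OF Z(2) cong_refl[of "int x"]] by (simp add: add.commute)
      then have "z + int x \<in> T (add_mset x Y)" using Z(1) unfolding T_def
        by (intro CollectI exI[of _ "add_mset x Z"]) auto
      then have "T Y \<subset> T (add_mset x Y)" using sub z by auto
      then have "residue_count (int d) (T Y) < residue_count (int d) (T (add_mset x Y))"
        by (rule residue_count_psubset[OF d' per per])
      moreover have "add_mset x Y \<subseteq># R"
        using Y cx by (auto simp: good_def subseteq_mset_def)
      ultimately have "good (add_mset x Y)" using Y by (auto simp: good_def)
      then show False using max by fastforce
    qed
    then have "d \<le> size Y" using nd[OF p(1)] size_mset_mono le_trans by blast
    then show False using Y residue_count_le[of "int d" "T Y"] by (auto simp: good_def)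
  qed
  then have "int r \<in> T Y" by simp
  then obtain Z where Z: "Z \<subseteq># Y" "[int r = int (\<Sum>\<^sub># Z)] (mod int d)" by (auto simp: T_def)
  have "size Z < d"
    using size_mset_mono[OF Z(1)] Y residue_count_le[of "int d" "T Y"] by (auto simp: good_def)
  moreover have "Z \<subseteq># R" using Z Y by (auto simp: good_def)
  ultimately show ?thesis using that Z cong_int_iff cong_sym by blast
qed

section \<open>Small submultisets with enough non-multiples of every prime\<close>

lemma exists_submset_size:
  assumes "k \<le> size X"
  obtains Y where "Y \<subseteq># X" "size Y = k"
proof -
  obtain xs where xs: "mset xs = X" using ex_mset by blast
  have "mset (take k xs) \<subseteq># X" unfolding xs[symmetric]
    by (metis append_take_drop_id mset_append mset_subset_eq_add_left)
  moreover have "size (mset (take k xs)) = k" using assms xs by auto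
  ultimately show ?thesis using that by blast
qed

lemma card_prime_factors_le_log:
  fixes x :: nat
  assumes "x > 0"
  shows "real (card (prime_factors x)) \<le> log 2 (real x)"
proof -
  have "2 ^ card (prime_factors x) = (\<Prod>p\<in>prime_factors x. 2::nat)" by simp
  also have "\<dots> \<le> (\<Prod>p\<in>prime_factors x. p ^ multiplicity p x)"
  proof (rule prod_mono, safe)
    fix p assume p: "p \<in> prime_factors x"
    then have "2 \<le> p" using prime_ge_2_nat by auto
    moreover have "p ^ 1 \<le> p ^ multiplicity p x"
      using p \<open>2 \<le> p\<close> by (intro power_increasing) (auto simp: prime_factors_multiplicity)
    ultimately show "2 \<le> p ^ multiplicity p x" by simp
  qed
  also have "\<dots> = x" using assms by (simp add: prime_factorization_nat[symmetric])
  finally have "real (2 ^ card (prime_factors x)) \<le> real x" by (simp only: of_nat_le_iff)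
  then show ?thesis using assms by (simp add: le_log_iff powr_realpow)
qed

lemma sum_size_filter_mset:
  assumes "finite P"
  shows "(\<Sum>p\<in>P. size {#x \<in># M. Q p x#}) = (\<Sum>x\<in>#M. card {p \<in> P. Q p x})"
proof (induction M)
  case (add x M)
  have "(\<Sum>p\<in>P. size {#y \<in># add_mset x M. Q p y#})
      = (\<Sum>p\<in>P. (if Q p x then 1 else 0) + size {#y \<in># M. Q p y#})" by (rule sum.cong) auto
  also have "\<dots> = card {p \<in> P. Q p x} + (\<Sum>p\<in>P. size {#y \<in># M. Q p y#})"
    using assms by (simp add: sum.distrib sum.If_cases Int_def)
  finally show ?case using add by simp
qed simp

lemma sum_mset_le_size_mult:
  fixes f :: "'a \<Rightarrow> 'b::linordered_semidom"
  assumes "\<And>x. x \<in># M \<Longrightarrow> f x \<le> c"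
  shows "(\<Sum>x\<in>#M. f x) \<le> of_nat (size M) * c"
  using assms
proof (induction M)
  case (add x M)
  then show ?case by (simp add: algebra_simps add_mono)
qed simp

text \<open>An arbitrary submultiset of size \<open>2 * t\<close> already serves all primes except those dividing
  at least half of its elements, and double counting leaves at most \<open>2 * u\<close> of these.\<close>

lemma exists_robust_submset:
  fixes X :: "nat multiset"
  assumes pos: "\<And>x. x \<in># X \<Longrightarrow> x > 0" and u: "\<And>x. x \<in># X \<Longrightarrow> real (card (prime_factors x)) \<le> u"
    and nd: "\<And>p. prime p \<Longrightarrow> t \<le> size {#x \<in># X. \<not> p dvd x#}" and size: "2 * t \<le> size X"
  obtains R where "R \<subseteq># X" "real (size R) \<le> real t * (2 + 2 * u)"
    "\<And>p. prime p \<Longrightarrow> t \<le> size {#x \<in># R. \<not> p dvd x#}"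
proof (cases "t = 0")
  case True
  then show ?thesis using that[of "{#}"] by simp
next
  case False
  obtain R0 where R0: "R0 \<subseteq># X" "size R0 = 2 * t" using exists_submset_size[OF size] by blast
  \<comment> \<open>The primes that \<open>R0\<close> does not serve: fewer than \<open>t\<close> of
    its \<open>2 * t\<close> elements avoid them.\<close>
  define P where "P = {p. prime p \<and> t < size {#x \<in># R0. p dvd x#}}"
  have R0X: "x \<in># X" if "x \<in># R0" for x using R0(1) that by (rule mset_subset_eqD)
  have "P \<subseteq> (\<Union>x\<in>set_mset R0. prime_factors x)"
  proof
    fix p assume p: "p \<in> P"
    then have "size {#x \<in># R0. p dvd x#} \<noteq> 0" unfolding P_def by (simp only: mem_Collect_eq) linarith
    then obtain x where "x \<in># {#x \<in># R0. p dvd x#}" by (metis multiset_nonemptyE size_empty)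
    then have "x \<in># R0" "p dvd x" by auto
    then show "p \<in> (\<Union>x\<in>set_mset R0. prime_factors x)"
      using p pos[OF R0X] by (auto simp: P_def prime_factors_dvd)
  qed
  then have fP: "finite P" by (rule finite_subset) auto
  \<comment> \<open>Double counting of divisibilities: more than \<open>t\<close> elements for each
    prime in \<open>P\<close>, at most \<open>u\<close> primes for each of the \<open>2 * t\<close>
    elements.\<close>
  have "real (card P) * real t = (\<Sum>p\<in>P. real t)" by simp
  also have "\<dots> \<le> (\<Sum>p\<in>P. real (size {#x \<in># R0. p dvd x#}))" by (intro sum_mono) (auto simp: P_def)
  also have "\<dots> = real (\<Sum>x\<in>#R0. card {p \<in> P. p dvd x})"
    using sum_size_filter_mset[OF fP, of "\<lambda>p x. p dvd x" R0] by (metis of_nat_sum)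
  also have "\<dots> = (\<Sum>x\<in>#R0. real (card {p \<in> P. p dvd x}))" by (simp add: image_mset.compositionality comp_def)
  also have "\<dots> \<le> real (size R0) * u"
  proof (rule sum_mset_le_size_mult)
    fix x assume x: "x \<in># R0"
    have "card {p \<in> P. p dvd x} \<le> card (prime_factors x)"
      using pos[OF R0X[OF x]] by (intro card_mono) (auto simp: P_def prime_factors_dvd)
    then show "real (card {p \<in> P. p dvd x}) \<le> u" using u[OF R0X[OF x]] by linarith
  qed
  finally have "real t * real (card P) \<le> real t * (2 * u)" using R0 by (simp add: mult_ac)
  then have cP: "real (card P) \<le> 2 * u" using False by simp
  have "\<exists>R. R0 \<subseteq># R \<and> R \<subseteq># X \<and> size R \<le> 2 * t + card Q * t \<and> (\<forall>p\<in>Q. t \<le> size {#x \<in># R. \<not> p dvd x#})"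
    if "finite Q" "Q \<subseteq> P" for Q
    using that
  proof (induction Q rule: finite_induct)
    case empty
    then show ?case using R0 by auto
  next
    case (insert p Q)
    then obtain R where R: "R0 \<subseteq># R" "R \<subseteq># X" "size R \<le> 2 * t + card Q * t"
      "\<forall>p\<in>Q. t \<le> size {#x \<in># R. \<not> p dvd x#}" by auto
    have "prime p" using insert by (auto simp: P_def)
    then obtain N where N: "N \<subseteq># {#x \<in># X. \<not> p dvd x#}" "size N = t"
      using exists_submset_size[OF nd] by blast
    \<comment> \<open>This union takes maximal multiplicities, so nothing is doubled and the result
      stays inside \<open>X\<close>.\<close>
    let ?R = "R \<union># N"
    have sub: "R \<subseteq># ?R" by simp
    have "N \<subseteq># X" using N multiset_filter_subset subset_mset.order_trans by blast
    then have "?R \<subseteq># X" using R by simp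
    moreover have "size ?R \<le> 2 * t + card (insert p Q) * t"
      using size_Un_Int[of R N] R N insert by simp
    moreover have "t \<le> size {#x \<in># ?R. \<not> p dvd x#}"
    proof -
      have "\<not> p dvd x" if "x \<in># N" for x using mset_subset_eqD[OF N(1) that] by simp
      then have "filter_mset (\<lambda>x. \<not> p dvd x) N = N" by (simp add: filter_mset_eq_conv)
      moreover have "filter_mset (\<lambda>x. \<not> p dvd x) N \<subseteq># filter_mset (\<lambda>x. \<not> p dvd x) ?R"
        by (rule multiset_filter_mono) simp
      ultimately show ?thesis using size_mset_mono N by metis
    qed
    moreover have "t \<le> size {#x \<in># ?R. \<not> p' dvd x#}" if "p' \<in> Q" for p'
      using R(4) that size_mset_mono[OF multiset_filter_mono[OF sub]] le_trans by blast
    moreover have "R0 \<subseteq># ?R" using R sub subset_mset.order_trans by blast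
    ultimately show ?case by blast
  qed
  from this[OF fP] obtain R where R: "R0 \<subseteq># R" "R \<subseteq># X" "size R \<le> 2 * t + card P * t"
    "\<forall>p\<in>P. t \<le> size {#x \<in># R. \<not> p dvd x#}" by auto
  have "t \<le> size {#x \<in># R. \<not> p dvd x#}" if "prime p" for p
  proof (cases "p \<in> P")
    case False
    then have "size {#x \<in># R0. p dvd x#} \<le> t" using that by (auto simp: P_def)
    moreover have "size R0 = size {#x \<in># R0. p dvd x#} + size {#x \<in># R0. \<not> p dvd x#}"
      by (metis multiset_partition size_union)
    ultimately have "t \<le> size {#x \<in># R0. \<not> p dvd x#}" using R0 by simp
    then show ?thesis using size_mset_mono[OF multiset_filter_mono[OF R(1)]] le_trans by blast
  qed (use R in auto)
  moreover have "real (size R) \<le> real t * (2 + 2 * u)"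
  proof -
    have "real (size R) \<le> real (2 * t + card P * t)" using R(3) by (simp only: of_nat_le_iff)
    also have "\<dots> = real t * (2 + real (card P))" by (simp add: algebra_simps)
    also have "\<dots> \<le> real t * (2 + 2 * u)" using cP by (intro mult_left_mono) auto
    finally show ?thesis .
  qed
  ultimately show ?thesis using that R by blast
qed

section \<open>From a progression to an interval\<close>

lemma subset_sums_add:
  assumes "s \<in> subset_sums A" "t \<in> subset_sums B"
  shows "s + t \<in> subset_sums (A + B)"
proof -
  obtain Y Z where "Y \<subseteq># A" "Z \<subseteq># B" "s = \<Sum>\<^sub># Y" "t = \<Sum>\<^sub># Z" using assms by (auto simp: subset_sums_def)
  then show ?thesis unfolding subset_sums_def
    by (intro CollectI exI[of _ "Y + Z"]) (auto intro: subset_mset.add_mono)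
qed

lemma subset_sums_mono: "A \<subseteq># B \<Longrightarrow> subset_sums A \<subseteq> subset_sums B"
  unfolding subset_sums_def using subset_mset.order_trans by blast

lemma subset_sums_complement:
  assumes "s \<in> subset_sums X"
  shows "\<Sum>\<^sub># X - s \<in> subset_sums X"
proof -
  obtain Y where "Y \<subseteq># X" "s = \<Sum>\<^sub># Y" using assms by (auto simp: subset_sums_def)
  then show ?thesis unfolding subset_sums_def
    by (intro CollectI exI[of _ "X - Y"]) (auto simp: sum_mset_diff)
qed

text \<open>Each new element is at most the length of the interval, so the interval and its
  translate leave no gap.\<close>

lemma subset_sums_extend_interval:
  assumes "{u..v} \<subseteq> subset_sums A" "u + m \<le> v" "\<And>x. x \<in># G \<Longrightarrow> x \<le> m"
  shows "{u..v + \<Sum>\<^sub># G} \<subseteq> subset_sums (A + G)"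
  using assms(3)
proof (induction G)
  case empty
  then show ?case using assms by simp
next
  case (add x G)
  have IH: "{u..v + \<Sum>\<^sub># G} \<subseteq> subset_sums (A + G)" using add by auto
  have x: "x \<le> m" using add.prems by simp
  show ?case
  proof
    fix t assume t: "t \<in> {u..v + \<Sum>\<^sub># (add_mset x G)}"
    show "t \<in> subset_sums (A + add_mset x G)"
    proof (cases "t \<le> v + \<Sum>\<^sub># G")
      case True
      then have "t \<in> subset_sums (A + G)" using IH t by auto
      moreover have "A + G \<subseteq># A + add_mset x G" by simp
      ultimately show ?thesis using subset_sums_mono by blast
    next
      case False
      then have "u \<le> t - x" "t - x \<le> v + \<Sum>\<^sub># G" using t x assms(2) by auto
      then have "t - x \<in> subset_sums (A + G)" using IH by (meson atLeastAtMost_iff subsetD)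
      moreover have "x \<in> subset_sums {#x#}" by (auto simp: subset_sums_def intro!: exI[of _ "{#x#}"])
      ultimately have "t - x + x \<in> subset_sums (A + G + {#x#})" by (rule subset_sums_add)
      then show ?thesis using False x assms(2) by simp
    qed
  qed
qed

text \<open>Fewer than \<open>d\<close> elements of \<open>R\<close> correct the residue of
  \<open>t - a\<close> modulo \<open>d\<close>. Their sum is at most \<open>d * m\<close>, which is
  why the interval starts that far beyond \<open>a\<close>; the rest is a multiple of
  \<open>d\<close> covered by the progression.\<close>

lemma subset_sums_interval_of_progression:
  assumes d: "d > 0" and prog: "\<And>y. y \<le> 2 * m \<Longrightarrow> a + d * y \<in> subset_sums A"
    and nd: "\<And>p. prime p \<Longrightarrow> d \<le> size {#x \<in># R. \<not> p dvd x#}" and R: "\<And>x. x \<in># R \<Longrightarrow> x \<le> m"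
  shows "{a + d * m..a + d * (2 * m)} \<subseteq> subset_sums (A + R)"
proof
  fix t assume t: "t \<in> {a + d * m..a + d * (2 * m)}"
  obtain Y where Y: "Y \<subseteq># R" "size Y < d" "[\<Sum>\<^sub># Y = t - a] (mod d)"
    using subset_sums_cover_residues[OF d nd] by blast
  have "\<Sum>\<^sub># Y \<le> size Y * m"
    using sum_mset_le_size_mult[of Y "\<lambda>x. x" m] R mset_subset_eqD[OF Y(1)] by auto
  also have "\<dots> \<le> d * m" using Y by simp
  finally have le: "\<Sum>\<^sub># Y \<le> t - a" using t by auto
  have "[int (t - a) = int (\<Sum>\<^sub># Y)] (mod int d)" using Y(3) by (simp only: cong_int_iff cong_sym_eq)
  then have "int d dvd int ((t - a) - \<Sum>\<^sub># Y)"
    using le by (simp only: cong_iff_dvd_diff of_nat_diff)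
  then have "d dvd (t - a) - \<Sum>\<^sub># Y" by (simp only: int_dvd_int_iff)
  then obtain y where y: "(t - a) - \<Sum>\<^sub># Y = d * y" by (rule dvdE)
  have "d * y \<le> d * (2 * m)" unfolding y[symmetric] using t unfolding atLeastAtMost_iff by linarith
  then have "y \<le> 2 * m" using d by simp
  then have "(a + d * y) + \<Sum>\<^sub># Y \<in> subset_sums (A + R)"
    using prog Y(1) by (intro subset_sums_add) (auto simp: subset_sums_def)
  moreover have "(a + d * y) + \<Sum>\<^sub># Y = t" using y le t by auto
  ultimately show "t \<in> subset_sums (A + R)" by simp
qed

section \<open>Dense multisets\<close>

lemma size_mult_le_sum_mset:
  fixes M :: "nat multiset"
  assumes "\<And>x. x \<in># M \<Longrightarrow> c \<le> n * x"
  shows "size M * c \<le> n * \<Sum>\<^sub># M"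
  using assms
proof (induction M)
  case (add x M)
  have "size M * c \<le> n * \<Sum>\<^sub># M" using add by simp
  moreover have "c \<le> n * x" using add.prems by simp
  ultimately show ?case by (simp add: add_mult_distrib2)
qed simp

lemma sum_mset_mono_submset:
  fixes A B :: "nat multiset"
  assumes "A \<subseteq># B"
  shows "\<Sum>\<^sub># A \<le> \<Sum>\<^sub># B"
  using assms by (metis le_add1 mset_subset_eq_exists_conv sum_mset.union)

text \<open>Markov's inequality at twice the average.\<close>

lemma size_small_elements:
  fixes X :: "nat multiset"
  assumes "\<Sum>\<^sub># X > 0"
  shows "2 * size {#x \<in># X. \<not> size X * x \<le> 2 * \<Sum>\<^sub># X#} \<le> size X"
proof -
  let ?B = "{#x \<in># X. \<not> size X * x \<le> 2 * \<Sum>\<^sub># X#}"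
  have "size ?B * (2 * \<Sum>\<^sub># X) \<le> size X * \<Sum>\<^sub># ?B" by (rule size_mult_le_sum_mset) auto
  also have "\<dots> \<le> size X * \<Sum>\<^sub># X" by (intro mult_le_mono2 sum_mset_mono_submset) simp
  finally have "(2 * size ?B) * \<Sum>\<^sub># X \<le> size X * \<Sum>\<^sub># X" by (simp only: mult_ac)
  then show ?thesis using assms by simp
qed

lemma nondivisible_part_eq: "nondivisible_part X d = {#x \<in># X. \<not> d dvd x#}"
  unfolding nondivisible_part_def divisible_part_def by (rule multiset_eqI) simp

text \<open>Restricting to elements below twice the average \<open>S / n\<close> makes the step of the progression
  of order \<open>L * \<mu> * S / n\<^sup>2\<close> instead of \<open>L * \<mu> * m / n\<close>.\<close>

lemma dense_mset_long_progression:
  fixes Z :: "nat multiset" and n m \<mu> S :: nat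
  defines "L \<equiv> log 2 (2 * real \<mu>)"
  assumes n: "0 < n" "n \<le> 8 * size Z" "size Z \<le> n"
    and cnt: "\<And>x. count Z x \<le> \<mu>" and Z: "\<And>x. x \<in># Z \<Longrightarrow> 0 < x \<and> x \<le> m \<and> n * x \<le> 2 * S"
    and dense: "32768 * log 2 (2 * real n) * L\<^sup>2 * real \<mu> * real m \<le> (real n)\<^sup>2"
  obtains a d A where "A \<subseteq># Z" "d > 0"
    "real d * (real n)\<^sup>2 \<le> 128 * L * real \<mu> * real S"
    "real a * (real n)\<^sup>2 \<le> 4096 * L * real \<mu> * real S * real m"
    "\<And>y. y \<le> 2 * m \<Longrightarrow> a + d * y \<in> subset_sums A"
proof -
  have "Z \<noteq> {#}" using n by auto
  then obtain K where K: "K \<in> {1..\<mu>}"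
    and KD: "real (size Z) \<le> real K * real (card {x \<in> set_mset Z. K \<le> count Z x}) * L"
    using popular_multiplicity[OF _ cnt] unfolding L_def by metis
  define D where "D = {x \<in> set_mset Z. K \<le> count Z x}"
  define v where "v = card D"
  define l where "l = log 2 (2 * real n)"
  have fin: "finite D" by (simp add: D_def)
  have mu: "\<mu> > 0" using K by simp
  then have L: "L \<ge> 1" by (simp add: L_def log_mult)
  have l: "l \<ge> 1" using n by (simp add: l_def log_mult)
  have nK: "real n \<le> 8 * (real K * real v * L)" using KD n unfolding D_def[symmetric] v_def by linarith
  then have v: "v > 0" using n by (cases "v = 0") auto
  then have ne: "D \<noteq> {}" by (auto simp: v_def)
  have "v \<le> card (set_mset Z)" unfolding v_def D_def by (intro card_mono) auto
  also have "\<dots> \<le> size Z" unfolding size_multiset_overloaded_eq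
    using sum_mono[of "set_mset Z" "\<lambda>_. 1" "count Z"] by (simp add: Suc_leI)
  finally have vn: "v \<le> n" using n by simp
  have sub: "repeat_mset K (mset_set D) \<subseteq># Z"
    unfolding subseteq_mset_def
  proof
    fix x show "count (repeat_mset K (mset_set D)) x \<le> count Z x"
      by (cases "x \<in> D") (auto simp: fin D_def)
  qed
  have lv: "log 2 (2 * real v) \<le> l" unfolding l_def using v vn by simp
  have "512 * real m * l \<le> (real v)\<^sup>2 * real K"
  proof -
    \<comment> \<open>Squaring \<open>n \<le> 8 * K * v * L\<close> and trading one factor
      \<open>K\<close> for \<open>\<mu>\<close> exposes the common factor
      \<open>64 * L\<^sup>2 * \<mu>\<close>, and \<open>32768 = 64 * 512\<close>.\<close>
    have "32768 * l * L\<^sup>2 * real \<mu> * real m \<le> (8 * (real K * real v * L))\<^sup>2"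
      using dense power_mono[OF nK, of 2] unfolding l_def by (rule order_trans) simp
    also have "\<dots> = 64 * L\<^sup>2 * ((real v)\<^sup>2 * real K) * real K" by (simp add: power2_eq_square)
    also have "\<dots> \<le> 64 * L\<^sup>2 * ((real v)\<^sup>2 * real K) * real \<mu>"
      using K by (intro mult_left_mono) auto
    finally have "(64 * L\<^sup>2 * real \<mu>) * (512 * real m * l) \<le> (64 * L\<^sup>2 * real \<mu>) * ((real v)\<^sup>2 * real K)"
      by (simp add: mult_ac)
    then show ?thesis by (rule mult_left_le_imp_le) (use L mu in simp)
  qed
  moreover have "512 * real m * log 2 (2 * real v) \<le> 512 * real m * l" using lv by (intro mult_left_mono) auto
  ultimately have dD: "512 * real m * log 2 (2 * real (card D)) \<le> (real (card D))\<^sup>2 * real K" by (simp add: v_def)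
  define M where "M = Max D"
  have "M \<in> D" unfolding M_def using fin ne by simp
  then have M: "M \<le> m" "n * M \<le> 2 * S" using Z by (auto simp: D_def)
  obtain a d where d: "d > 0" "d * v \<le> 8 * M" and a: "a * v \<le> 256 * M * m"
    and prog: "\<And>y. y \<le> 2 * m \<Longrightarrow> a + d * y \<in> subset_sums (repeat_mset K (mset_set D))"
  proof (rule subset_sums_long_progression[OF fin ne _ _ M(1) _ dD])
    show "0 < x" if "x \<in> D" for x using that Z by (auto simp: D_def)
    show "x \<le> M" if "x \<in> D" for x using that fin by (simp add: M_def)
    show "0 < K" using K by simp
  qed (auto simp: v_def)
  have nmu: "real n \<le> 8 * L * real \<mu> * real v"
  proof -
    have "real K * real v * L \<le> real \<mu> * real v * L" using K L by (intro mult_right_mono) auto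
    then show ?thesis using nK by (simp add: mult_ac)
  qed
  \<comment> \<open>Bounds in \<open>v\<close> and \<open>M\<close> become bounds in
    \<open>n\<close> and \<open>S\<close> through \<open>n \<le> 8 * L * \<mu> * v\<close> and
    \<open>n * M \<le> 2 * S\<close>. This serves \<open>d\<close> with \<open>b = 8\<close> and
    \<open>a\<close> with \<open>b = 256 * m\<close>.\<close>
  have step: "real c * (real n)\<^sup>2 \<le> 16 * L * real \<mu> * real S * real b" if cb: "c * v \<le> b * M" for c b :: nat
  proof -
    have "(c * v) * n \<le> (b * M) * n" using cb by (rule mult_le_mono1)
    also have "\<dots> = b * (n * M)" by simp
    also have "\<dots> \<le> b * (2 * S)" using M by (intro mult_le_mono2)
    finally have "real (c * v * n) \<le> real (b * (2 * S))" by (simp only: of_nat_le_iff)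
    then have *: "real c * real n * real v \<le> 2 * real b * real S" by (simp add: mult_ac)
    have "real c * (real n)\<^sup>2 = (real c * real n) * real n" by (simp add: power2_eq_square)
    also have "\<dots> \<le> (real c * real n) * (8 * L * real \<mu> * real v)" using nmu by (intro mult_left_mono) auto
    also have "\<dots> = (8 * L * real \<mu>) * (real c * real n * real v)" by simp
    also have "\<dots> \<le> (8 * L * real \<mu>) * (2 * real b * real S)" using * L by (intro mult_left_mono) auto
    also have "\<dots> = 16 * L * real \<mu> * real S * real b" by simp
    finally show ?thesis .
  qed
  show ?thesis
  proof (rule that[OF sub d(1)])
    show "real d * (real n)\<^sup>2 \<le> 128 * L * real \<mu> * real S" using step[OF d(2)] by simp
    have "a * v \<le> (256 * m) * M" using a by (simp add: mult_ac)
    from step[OF this] show "real a * (real n)\<^sup>2 \<le> 4096 * L * real \<mu> * real S * real m" by simp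
  qed (use prog in auto)
qed

section \<open>Splitting the multiset and collecting the numerical bounds\<close>

theorem theorem4p2:
  fixes X :: "nat multiset" and n :: nat and C_delta C_alpha C_lambda lambda_X :: real
  assumes "X \<noteq> {#}" and "\<And>x. x \<in># X \<Longrightarrow> x > 0" and "size X = n"
    and "C_delta = 1699200 * log 2 (2 * real n) * (log 2 (2 * real (max_multiplicity X)))\<^sup>2"
    and "C_alpha = 42480 * log 2 (2 * real (max_multiplicity X))"
    and "C_lambda = 169920 * log 2 (2 * real (max_multiplicity X))"
    and "dense_mset C_delta X"
    and "\<not> (\<exists>d. almost_divisor C_alpha X d)"
    and "lambda_X = C_lambda * real (max_multiplicity X) * real (Max_mset X) * real (\<Sum>\<^sub># X)
               / (real (size X))\<^sup>2"
  shows "{t :: nat. lambda_X \<le> real t \<and> real t \<le> real (\<Sum>\<^sub># X) - lambda_X} \<subseteq> subset_sums X"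
proof -
  define \<mu> where "\<mu> = max_multiplicity X"
  define m where "m = Max_mset X"
  define S where "S = \<Sum>\<^sub># X"
  define L where "L = log 2 (2 * real \<mu>)"
  define l where "l = log 2 (2 * real n)"
  define \<tau> where "\<tau> = C_alpha * real \<mu> * real S / (real n)\<^sup>2"
  have n: "n > 0" using assms(1,3) by (metis gr0I size_eq_0_iff_empty)
  have cnt: "count X x \<le> \<mu>" for x
  proof (cases "x \<in># X")
    case True
    then show ?thesis unfolding \<mu>_def max_multiplicity_def by (intro Max_ge) auto
  qed (simp add: not_in_iff)
  have xm: "x \<le> m" if "x \<in># X" for x unfolding m_def using that by simp
  obtain x0 where x0: "x0 \<in># X" using assms(1) by auto
  have m: "m > 0" using xm[OF x0] assms(2)[OF x0] by simp
  have "count X x0 > 0" using x0 by (rule count_greater_zero_iff[THEN iffD2])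
  then have mu: "\<mu> > 0" using cnt[of x0] by linarith
  have L: "L \<ge> 1" using mu by (simp add: L_def log_mult)
  have l: "l \<ge> 1" using n by (simp add: l_def log_mult)
  have S: "S > 0" using size_mult_le_sum_mset[of X 1 1] assms(2) n assms(3) by (simp add: S_def Suc_leI)
  have Snm: "S \<le> n * m" using sum_mset_le_size_mult[of X "\<lambda>x. x" m] xm assms(3) by (simp add: S_def)
  have dense: "1699200 * l * L\<^sup>2 * real \<mu> * real m \<le> (real n)\<^sup>2"
    using assms(7) assms(3) unfolding dense_mset_def assms(4) L_def l_def \<mu>_def m_def by simp
  have \<tau>n: "\<tau> * (real n)\<^sup>2 = 42480 * L * real \<mu> * real S"
    using n unfolding \<tau>_def assms(5) L_def \<mu>_def by simp
  \<comment> \<open>\<open>C_lambda\<close> is four times \<open>C_alpha\<close>: one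
    \<open>\<tau> * m\<close> pays for correcting residues and three for the start
    \<open>a\<close>.\<close>
  have lam: "lambda_X = 4 * \<tau> * real m"
    unfolding assms(9) assms(6) \<tau>_def assms(5) using assms(3) by (simp add: \<mu>_def m_def S_def)
  have \<tau>0: "\<tau> \<ge> 0" unfolding \<tau>_def assms(5) using L by (simp add: L_def \<mu>_def)
  \<comment> \<open>Density in terms of \<open>\<tau>\<close>, with
    \<open>1699200 = 40 * 42480\<close>.\<close>
  have \<tau>S: "40 * l * L * \<tau> * real m \<le> real S"
  proof -
    have "(40 * l * L * \<tau> * real m) * (real n)\<^sup>2 = 40 * l * L * real m * (\<tau> * (real n)\<^sup>2)" by simp
    also have "\<dots> = (1699200 * l * L\<^sup>2 * real \<mu> * real m) * real S"
      unfolding \<tau>n by (simp add: power2_eq_square)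
    also have "\<dots> \<le> (real n)\<^sup>2 * real S" using dense by (intro mult_right_mono) auto
    finally have "(40 * l * L * \<tau> * real m) * (real n)\<^sup>2 \<le> real S * (real n)\<^sup>2" by (simp only: mult.commute)
    then show ?thesis by (rule mult_right_le_imp_le) (use n in simp)
  qed
  have l\<tau>: "40 * (l * \<tau> * real m) \<le> real S"
  proof -
    have "(40 * l * \<tau> * real m) * 1 \<le> (40 * l * \<tau> * real m) * L"
      using L l \<tau>0 by (intro mult_left_mono) auto
    then show ?thesis using \<tau>S by (simp add: mult_ac)
  qed
  have l\<tau>n: "40 * (l * \<tau>) \<le> real n"
  proof -
    have "real S \<le> real (n * m)" using Snm by (simp only: of_nat_le_iff)
    then have "(40 * (l * \<tau>)) * real m \<le> real n * real m" using l\<tau> by simp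
    then show ?thesis by (rule mult_right_le_imp_le) (use m in simp)
  qed
  \<comment> \<open>This crude consequence of density gives \<open>n \<ge> 1000\<close>, and
    \<open>m \<le> n\<^sup>2\<close>, so that each element has few prime factors.\<close>
  have big: "1699200 * real m \<le> (real n)\<^sup>2"
  proof -
    have "1 * 1 \<le> l * L\<^sup>2" using l L by (intro mult_mono) auto
    then have "1 * 1 \<le> (l * L\<^sup>2) * real \<mu>" using mu by (intro mult_mono) auto
    then have "(1699200 * real m) * 1 \<le> (1699200 * real m) * (l * L\<^sup>2 * real \<mu>)"
      by (intro mult_left_mono) auto
    then show ?thesis using dense by (simp add: mult_ac)
  qed
  have n1000: "n \<ge> 1000"
  proof (rule ccontr)
    assume "\<not> n \<ge> 1000"
    then have "(real n)\<^sup>2 \<le> 1000\<^sup>2" by (intro power_mono) auto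
    then show False using big m by simp
  qed
  \<comment> \<open>An integer step \<open>d \<le> \<tau>\<close> is also at most the floor, so
    rounding costs nothing.\<close>
  define t where "t = nat \<lfloor>\<tau>\<rfloor>"
  have t\<tau>: "real t \<le> \<tau>" using \<tau>0 by (simp add: t_def)
  have nd: "t \<le> size {#x \<in># X. \<not> p dvd x#}" if "prime p" for p
  proof -
    have "\<not> almost_divisor C_alpha X p" using assms(8) by blast
    then have "\<tau> < real (size {#x \<in># X. \<not> p dvd x#})"
      using prime_gt_1_nat[OF that] assms(3)
      by (simp add: almost_divisor_def nondivisible_part_eq \<tau>_def \<mu>_def S_def)
    then show ?thesis using t\<tau> by linarith
  qed
  \<comment> \<open>The base 2 logarithm of \<open>n\<^sup>2\<close>; it keeps
    \<open>2 + 2 * u\<close> below \<open>4 * l\<close>.\<close>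
  define u where "u = 2 * (l - 1)"
  have omega: "real (card (prime_factors x)) \<le> u" if "x \<in># X" for x
  proof -
    have "real x \<le> (real n)\<^sup>2" using xm[OF that] big by linarith
    then have "log 2 (real x) \<le> log 2 ((real n)\<^sup>2)" using assms(2)[OF that] n by (subst log_le_cancel_iff) auto
    also have "\<dots> = u" using n by (simp add: u_def l_def log_mult log_nat_power)
    finally show ?thesis using card_prime_factors_le_log[OF assms(2)[OF that]] by linarith
  qed
  have "1 * \<tau> \<le> l * \<tau>" using l \<tau>0 by (intro mult_right_mono) auto
  then have "2 * t \<le> size X" using l\<tau>n t\<tau> n assms(3) by simp
  then obtain R where R: "R \<subseteq># X" "real (size R) \<le> real t * (2 + 2 * u)"
    "\<And>p. prime p \<Longrightarrow> t \<le> size {#x \<in># R. \<not> p dvd x#}"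
    using exists_robust_submset[OF assms(2) omega nd] by blast
  have sR: "real (size R) \<le> 4 * (l * \<tau>)"
  proof -
    note R(2)
    also have "real t * (2 + 2 * u) \<le> \<tau> * (4 * l)" using t\<tau> \<tau>0 l by (intro mult_mono) (auto simp: u_def)
    finally show ?thesis by (simp only: mult_ac)
  qed
  have RX: "x \<le> m" if "x \<in># R" for x using xm mset_subset_eqD[OF R(1) that] by blast
  have SR: "10 * real (\<Sum>\<^sub># R) \<le> real S"
  proof -
    have "\<Sum>\<^sub># R \<le> size R * m" using sum_mset_le_size_mult[of R "\<lambda>x. x" m] RX by simp
    then have "real (\<Sum>\<^sub># R) \<le> real (size R) * real m" by (metis of_nat_le_iff of_nat_mult)
    also have "\<dots> \<le> 4 * (l * \<tau>) * real m" using sR by (intro mult_right_mono) auto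
    also have "\<dots> = 4 * (l * \<tau> * real m)" by simp
    finally show ?thesis using l\<tau> by linarith
  qed
  define W where "W = {#x \<in># X - R. n * x \<le> 2 * S#}"
  \<comment> \<open>Removing \<open>R\<close> (at most \<open>n / 10\<close> elements) and the
    elements above twice the average (at most \<open>n / 2\<close>) leaves
    \<open>2 * n / 5\<close>.\<close>
  have "n div 5 \<le> size W"
  proof -
    have "size (X - R) = size W + size {#x \<in># X - R. \<not> n * x \<le> 2 * S#}"
      unfolding W_def by (metis multiset_partition size_union)
    moreover have "size {#x \<in># X - R. \<not> n * x \<le> 2 * S#} \<le> size {#x \<in># X. \<not> n * x \<le> 2 * S#}"
      by (intro size_mset_mono multiset_filter_mono) simp
    moreover have "2 * size {#x \<in># X. \<not> n * x \<le> 2 * S#} \<le> n"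
      using size_small_elements[of X] S assms(3) by (simp add: S_def)
    moreover have "size (X - R) = n - size R" using size_Diff_submset[OF R(1)] assms(3) by simp
    moreover have "10 * size R \<le> n" using sR l\<tau>n by linarith
    ultimately show ?thesis by linarith
  qed
  \<comment> \<open>Taking only a fifth keeps the sum of \<open>Z\<close>, whose elements are at
    most \<open>2 * S / n\<close>, below \<open>2 * S / 5\<close>, which leaves enough for
    \<open>G\<close>.\<close>
  then obtain Z where Z: "Z \<subseteq># W" "size Z = n div 5" using exists_submset_size by blast
  have ZX: "Z \<subseteq># X - R" using Z(1) multiset_filter_subset subset_mset.order_trans unfolding W_def by blast
  have Zel: "x \<in># X \<and> n * x \<le> 2 * S" if "x \<in># Z" for x
    using mset_subset_eqD[OF Z(1) that] by (auto simp: W_def dest: in_diffD)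
  have "Z \<subseteq># X" using ZX diff_subset_eq_self subset_mset.order_trans by blast
  then have cntZ: "count Z x \<le> \<mu>" for x using cnt[of x] mset_subset_eq_count le_trans by metis
  have "32768 * l * L\<^sup>2 * real \<mu> * real m \<le> 1699200 * l * L\<^sup>2 * real \<mu> * real m"
    using l by (intro mult_right_mono) auto
  then have dense': "32768 * l * L\<^sup>2 * real \<mu> * real m \<le> (real n)\<^sup>2" using dense by linarith
  have nZ: "n \<le> 8 * size Z" "size Z \<le> n" using Z(2) n1000 by auto
  have Zel': "0 < x \<and> x \<le> m \<and> n * x \<le> 2 * S" if "x \<in># Z" for x using Zel[OF that] assms(2) xm by blast
  obtain a d A where A: "A \<subseteq># Z" and d: "d > 0"
    and dn: "real d * (real n)\<^sup>2 \<le> 128 * L * real \<mu> * real S"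
    and an: "real a * (real n)\<^sup>2 \<le> 4096 * L * real \<mu> * real S * real m"
    and prog: "\<And>y. y \<le> 2 * m \<Longrightarrow> a + d * y \<in> subset_sums A"
    using dense_mset_long_progression[OF n nZ cntZ Zel' dense'[unfolded L_def l_def]] unfolding L_def by metis
  have n2: "(real n)\<^sup>2 > 0" using n by simp
  have LS: "0 \<le> L * real \<mu> * real S" using L by simp
  \<comment> \<open>The constants have ample room: 128 against 42480 here, and 4096 against three
    times 42480 for \<open>a\<close>.\<close>
  have d\<tau>: "real d \<le> \<tau>"
  proof -
    have "real d * (real n)\<^sup>2 \<le> \<tau> * (real n)\<^sup>2" unfolding \<tau>n using dn LS by linarith
    then show ?thesis using n2 by (rule mult_right_le_imp_le)
  qed
  then have dt: "d \<le> t" by (simp add: t_def le_nat_iff le_floor_iff)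
  have a\<tau>: "real a \<le> 3 * \<tau> * real m"
  proof -
    have "3 * \<tau> * real m * (real n)\<^sup>2 = 3 * real m * (\<tau> * (real n)\<^sup>2)" by simp
    also have "\<dots> = 127440 * (L * real \<mu> * real S * real m)" unfolding \<tau>n by simp
    finally have "real a * (real n)\<^sup>2 \<le> 3 * \<tau> * real m * (real n)\<^sup>2"
      using an mult_nonneg_nonneg[OF LS, of "real m"] by linarith
    then show ?thesis using n2 by (rule mult_right_le_imp_le)
  qed
  have start: "real (a + d * m) \<le> lambda_X"
  proof -
    have "real d * real m \<le> \<tau> * real m" using d\<tau> by (intro mult_right_mono) auto
    then show ?thesis unfolding lam using a\<tau> by simp
  qed
  have AR: "{a + d * m..a + d * (2 * m)} \<subseteq> subset_sums (A + R)"
    using R(3) dt le_trans by (intro subset_sums_interval_of_progression[OF d prog _ RX]) blast+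
  define G where "G = X - R - A"
  have AXR: "A \<subseteq># X - R" using A ZX subset_mset.order_trans by blast
  have X: "X = A + R + G" unfolding G_def using R(1) AXR
    by (metis add.commute add.left_commute subset_mset.add_diff_inverse union_assoc)
  have Gm: "x \<le> m" if "x \<in># G" for x using that xm by (auto simp: G_def dest: in_diffD)
  have len: "a + d * m + m \<le> a + d * (2 * m)" using d by (simp add: algebra_simps)
  have int: "{a + d * m..a + d * (2 * m) + \<Sum>\<^sub># G} \<subseteq> subset_sums X"
    by (subst X) (rule subset_sums_extend_interval[OF AR len Gm])
  have SA: "5 * \<Sum>\<^sub># A \<le> 2 * S"
  proof -
    have "n * \<Sum>\<^sub># Z = (\<Sum>x\<in>#Z. n * x)" using sum_mset_distrib_left[of n "\<lambda>x. x" Z] by simp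
    also have "\<dots> \<le> size Z * (2 * S)"
      using sum_mset_le_size_mult[of Z "\<lambda>x. n * x" "2 * S"] Zel by simp
    finally have "n * \<Sum>\<^sub># Z \<le> size Z * (2 * S)" .
    then have "5 * (n * \<Sum>\<^sub># Z) \<le> 5 * (size Z * (2 * S))" by (rule mult_le_mono2)
    also have "\<dots> = (5 * size Z) * (2 * S)" by (simp only: mult.assoc)
    also have "\<dots> \<le> n * (2 * S)" unfolding Z(2) by (intro mult_le_mono1) simp
    finally have "n * (5 * \<Sum>\<^sub># Z) \<le> n * (2 * S)" by (simp only: mult.left_commute)
    then have "5 * \<Sum>\<^sub># Z \<le> 2 * S" using n by simp
    then show ?thesis using sum_mset_mono_submset[OF A] by linarith
  qed
  have "S = \<Sum>\<^sub># A + \<Sum>\<^sub># R + \<Sum>\<^sub># G" unfolding S_def by (subst X) simp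
  \<comment> \<open>\<open>A\<close> and \<open>R\<close> take at most \<open>2 * S / 5\<close> and
    \<open>S / 10\<close>, together half of \<open>S\<close>.\<close>
  then have SG: "S \<le> 2 * \<Sum>\<^sub># G" using SA SR by linarith
  have half: "s \<in> subset_sums X" if "lambda_X \<le> real s" "2 * s \<le> S" for s
  proof -
    have "a + d * m \<le> s" using start that(1) by linarith
    moreover have "s \<le> a + d * (2 * m) + \<Sum>\<^sub># G" using that(2) SG by linarith
    ultimately show ?thesis using int by (meson atLeastAtMost_iff subsetD)
  qed
  show ?thesis
  proof
    fix s :: nat
    assume "s \<in> {t. lambda_X \<le> real t \<and> real t \<le> real (\<Sum>\<^sub># X) - lambda_X}"
    then have s: "lambda_X \<le> real s" "real s \<le> real S - lambda_X" unfolding S_def by blast+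
    show "s \<in> subset_sums X"
    proof (cases "2 * s \<le> S")
      case True
      then show ?thesis using half s by blast
    next
      case False
      have "0 \<le> lambda_X" unfolding lam using \<tau>0 by simp
      then have le: "s \<le> S" using s by linarith
      then have "S - s \<in> subset_sums X" using s False by (intro half) (auto simp: of_nat_diff)
      then have "S - (S - s) \<in> subset_sums X" unfolding S_def by (rule subset_sums_complement)
      then show ?thesis using le by simp
    qed
  qed
qed

end
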